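(* Let $G_1,G_2$ be univariate extreme value distribution functions, and let $F_j=(1+\log G_j)_+$ for $j=1,2$. Given a Pickands dependence function $A$, let $G$ be the bivariate extreme value distribution function $$G=\exp\left[\big(\log G_1+\log G_2\big)A\left(\frac{\log G_1}{\log G_1+\log G_2}\right)\right]$$ (where $G_1(x_1),G_2(x_2)>0$, with value $1$ if $G_1(x_1)=G_2(x_2)=1$, and $G(x_1,x_2)=0$ elsewhere), and let $F=C_A(F_1,F_2)$, where $C_A$ is the copula determined by $$C_A(u,v)=\frac{uv}{-1+u+v+(2-u-v)A\left(\frac{1-u}{2-u-v}\right)},\qquad (u,v)\in(0,1)^2.$$ Then the classical max-domain of attraction of $G$ and the bi-free max-domain of attraction of $F$ coincide, $\mathcal{D}_*(G)=\mathcal{D}_\star(F)$, and the normalizing vectors are also the same: for a bivariate distribution function $H$ and sequences $a_n,c_n>0$, $b_n,d_n\in\mathbb{R}$, one has $H^n(a_nx_1+b_n,c_nx_2+d_n)\to G(x_1,x_2)$ weakly if and only if $H^{\star n}(a_nx_1+b_n,c_nx_2+d_n)\to F(x_1,x_2)$ weakly.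
   Context: A bivariate distribution function is $F(x_1,x_2)=\mu((-\infty,x_1]\times(-\infty,x_2])$ for a Borel probability measure $\mu$ on $\mathbb{R}^2$; $F_1,F_2$ denote its marginal distribution functions. $c_+=\max\{c,0\}$, and $(1+\log 0)_+=0$. Bi-free max-convolution: for bivariate distribution functions $F,G$, $H=F\star G$ is the (unique) bivariate distribution function with marginals $H_j=(F_j+G_j-1)_+$ on $\mathbb{R}$, $j=1,2$, and such that $\frac{H_1H_2}{H}=\frac{F_1F_2}{F}+\frac{G_1G_2}{G}-1$ at each $\mathbf{x}$ where $F(\mathbf{x}),G(\mathbf{x}),H_1(x_1),H_2(x_2)$ are all strictly positive, and $H(\mathbf{x})=0$ at all other $\mathbf{x}$. The operation is well defined, commutative and associative; $F^{\star n}$ is the $n$-fold convolution of $F$ with itself. $\mathcal{D}_\star(F)$ is the set of bivariate distribution functions $H$ for which there are $a_n,c_n>0$, $b_n,d_n\in\mathbb{R}$ with $H^{\star n}(a_nx_1+b_n,c_nx_2+d_n)\to F(x_1,x_2)$ weakly as $n\to\infty$ (i.e. at continuity points of $F$). $\mathcal{D}_*(G)$ is the set of $H$ for which there are such constants with $H^{n}(a_nx_1+b_n,c_nx_2+d_n)\to G(x_1,x_2)$ weakly, where $H^n$ is the pointwise power. A univariate extreme value distribution function is $G(x)=\exp[-(1+\xi\frac{x-m}{\sigma})^{-1/\xi}]$ for $1+\xi(x-m)/\sigma>0$ (extended by $0$ or $1$ elsewhere; for $\xi=0$ it is $\exp[-e^{-(x-m)/\sigma}]$), with $\xi,m\in\mathbb{R}$,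 $\sigma>0$. A Pickands dependence function is a function $A:[0,1]\to[1/2,1]$ of the form $A(t)=\int_{S_2}\max\{tx,(1-t)y\}\,d\rho(x,y)$, where $\rho$ is a finite positive Borel measure on $S_2=\{(x,y)\in[0,1]^2:x+y=1\}$ with $\int x\,d\rho=\int y\,d\rho=1$ (equivalently, $A$ is convex with $t\vee(1-t)\le A(t)\le1$). The function $C_A$ on $(0,1)^2$ extends continuously to a copula on $[0,1]^2$ (so $C_A(u,0)=C_A(0,v)=0$, $C_A(u,1)=u$, $C_A(1,v)=v$), also denoted $C_A$. *)

theory Defs
  imports "HOL-Probability.Probability"
begin

section \<open>Bivariate distribution functions\<close>

definition is_bivariate_df :: "(real \<Rightarrow> real \<Rightarrow> real) \<Rightarrow> bool" where
  "is_bivariate_df F \<longleftrightarrow>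
     (\<exists>\<mu> :: (real \<times> real) measure. prob_space \<mu> \<and> sets \<mu> = sets borel \<and>
        (\<forall>x1 x2. F x1 x2 = measure \<mu> ({..x1} \<times> {..x2})))"

definition marginal1 :: "(real \<Rightarrow> real \<Rightarrow> real) \<Rightarrow> real \<Rightarrow> real" where
  "marginal1 F x1 = Lim at_top (\<lambda>x2. F x1 x2)"

definition marginal2 :: "(real \<Rightarrow> real \<Rightarrow> real) \<Rightarrow> real \<Rightarrow> real" where
  "marginal2 F x2 = Lim at_top (\<lambda>x1. F x1 x2)"

definition weak_conv2 :: "(nat \<Rightarrow> real \<Rightarrow> real \<Rightarrow> real) \<Rightarrow> (real \<Rightarrow> real \<Rightarrow> real) \<Rightarrow> bool" where
  "weak_conv2 Fs F \<longleftrightarrow>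
     (\<forall>x1 x2. isCont (\<lambda>(y1, y2). F y1 y2) (x1, x2) \<longrightarrow> (\<lambda>n. Fs n x1 x2) \<longlonglongrightarrow> F x1 x2)"

lemma tendsto_marginals:
  assumes \<mu>: "prob_space \<mu>" "sets \<mu> = sets (borel :: (real \<times> real) measure)"
    and F: "\<And>x1 x2. F x1 x2 = measure \<mu> ({..x1} \<times> {..x2})"
  shows "((\<lambda>x2. F x1 x2) \<longlongrightarrow> measure \<mu> ({..x1} \<times> UNIV)) at_top"
    and "((\<lambda>x1. F x1 x2) \<longlongrightarrow> measure \<mu> (UNIV \<times> {..x2})) at_top"
proof -
  interpret prob_space \<mu> by fact
  have cl: "A \<in> sets \<mu>" if "closed A" for A
    using that by (simp add: \<mu>(2) borel_closed)
  have ev: "(\<Union>n::nat. {..real n}) = UNIV"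
    using real_arch_simple by auto
  have U1: "(\<Union>n::nat. {..x1} \<times> {..real n}) = {..x1} \<times> UNIV"
    and U2: "(\<Union>n::nat. {..real n} \<times> {..x2}) = UNIV \<times> {..x2}"
    using ev by auto
  have "(\<lambda>n. F x1 (real n)) \<longlonglongrightarrow> measure \<mu> ({..x1} \<times> UNIV)"
    unfolding F U1[symmetric]
    by (rule finite_Lim_measure_incseq) (auto simp: incseq_def intro!: cl closed_Times)
  moreover have "mono (\<lambda>x2. F x1 x2)"
    by (auto simp: F mono_def intro!: finite_measure_mono cl closed_Times)
  ultimately show "((\<lambda>x2. F x1 x2) \<longlongrightarrow> measure \<mu> ({..x1} \<times> UNIV)) at_top"
    by (rule tendsto_at_topI_sequentially_real[rotated])
  have "(\<lambda>n. F (real n) x2) \<longlonglongrightarrow> measure \<mu> (UNIV \<times> {..x2})"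
    unfolding F U2[symmetric]
    by (rule finite_Lim_measure_incseq) (auto simp: incseq_def intro!: cl closed_Times)
  moreover have "mono (\<lambda>x1. F x1 x2)"
    by (auto simp: F mono_def intro!: finite_measure_mono cl closed_Times)
  ultimately show "((\<lambda>x1. F x1 x2) \<longlongrightarrow> measure \<mu> (UNIV \<times> {..x2})) at_top"
    by (rule tendsto_at_topI_sequentially_real[rotated])
qed

lemma marginal_eq_cdf:
  assumes \<mu>: "prob_space \<mu>" "sets \<mu> = sets (borel :: (real \<times> real) measure)"
    and F: "\<And>x1 x2. F x1 x2 = measure \<mu> ({..x1} \<times> {..x2})"
  shows "marginal1 F = cdf (distr \<mu> borel fst)" "marginal2 F = cdf (distr \<mu> borel snd)"
proof -
  have sp: "space \<mu> = UNIV" using sets_eq_imp_space_eq[OF \<mu>(2)] by simp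
  have m: "fst \<in> measurable \<mu> borel" "snd \<in> measurable \<mu> borel"
    unfolding measurable_cong_sets[OF \<mu>(2) refl]
    by (auto intro!: borel_measurable_continuous_onI continuous_intros)
  have v: "fst -` {..x} = {..x} \<times> (UNIV :: real set)"
    "snd -` {..x} = (UNIV :: real set) \<times> {..x}" for x :: real
    by auto
  show "marginal1 F = cdf (distr \<mu> borel fst)"
    using tendsto_Lim[OF _ tendsto_marginals(1)[OF assms]]
    by (auto simp: fun_eq_iff marginal1_def cdf_def measure_distr m sp v)
  show "marginal2 F = cdf (distr \<mu> borel snd)"
    using tendsto_Lim[OF _ tendsto_marginals(2)[OF assms]]
    by (auto simp: fun_eq_iff marginal2_def cdf_def measure_distr m sp v)
qed

section \<open>Bi-free max-convolution\<close>

text \<open>The defining relation \<open>H1 H2 / H = F1 F2 / F + G1 G2 / G - 1\<close> is solved for \<open>H\<close>.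
  The lemma \<open>maxconv_relation_iff\<close> below shows that the result satisfies the defining relation and
  the condition on the marginals, and that it is the only function to do so.\<close>

definition bifree_maxconv ::
  "(real \<Rightarrow> real \<Rightarrow> real) \<Rightarrow> (real \<Rightarrow> real \<Rightarrow> real) \<Rightarrow> real \<Rightarrow> real \<Rightarrow> real" (infixl "\<star>" 70) where
  "(F \<star> G) x1 x2 =
     (let F1 = marginal1 F x1; F2 = marginal2 F x2;
          G1 = marginal1 G x1; G2 = marginal2 G x2;
          H1 = max 0 (F1 + G1 - 1); H2 = max 0 (F2 + G2 - 1)
      in if F x1 x2 > 0 \<and> G x1 x2 > 0 \<and> H1 > 0 \<and> H2 > 0
         then H1 * H2 / (F1 * F2 / F x1 x2 + G1 * G2 / G x1 x2 - 1)
         else 0)"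

definition maxconv_relation ::
  "(real \<Rightarrow> real \<Rightarrow> real) \<Rightarrow> (real \<Rightarrow> real \<Rightarrow> real) \<Rightarrow> (real \<Rightarrow> real \<Rightarrow> real) \<Rightarrow> bool" where
  "maxconv_relation F G H \<longleftrightarrow>
     (\<forall>x1. marginal1 H x1 = max 0 (marginal1 F x1 + marginal1 G x1 - 1)) \<and>
     (\<forall>x2. marginal2 H x2 = max 0 (marginal2 F x2 + marginal2 G x2 - 1)) \<and>
     (\<forall>x1 x2.
        if F x1 x2 > 0 \<and> G x1 x2 > 0 \<and> marginal1 H x1 > 0 \<and> marginal2 H x2 > 0
        then marginal1 H x1 * marginal2 H x2 / H x1 x2 =
               marginal1 F x1 * marginal2 F x2 / F x1 x2 +
               marginal1 G x1 * marginal2 G x2 / G x1 x2 - 1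
        else H x1 x2 = 0)"

lemma bivariate_df_facts:
  assumes "is_bivariate_df F"
  shows "0 \<le> F x1 x2" "F x1 x2 \<le> marginal1 F x1" "F x1 x2 \<le> marginal2 F x2"
    "marginal1 F x1 \<le> 1" "marginal2 F x2 \<le> 1"
    "((\<lambda>x2. F x1 x2) \<longlongrightarrow> marginal1 F x1) at_top"
    "((\<lambda>x1. F x1 x2) \<longlongrightarrow> marginal2 F x2) at_top"
    "(marginal1 F \<longlongrightarrow> 1) at_top" "(marginal2 F \<longlongrightarrow> 1) at_top"
proof -
  obtain \<mu> where \<mu>: "prob_space \<mu>" "sets \<mu> = sets (borel :: (real \<times> real) measure)"
    and F: "\<And>x1 x2. F x1 x2 = measure \<mu> ({..x1} \<times> {..x2})"
    using assms unfolding is_bivariate_df_def by blast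
  interpret prob_space \<mu> by fact
  have cl: "A \<in> sets \<mu>" if "closed A" for A
    using that by (simp add: \<mu>(2) borel_closed)
  have m1: "marginal1 F x1 = measure \<mu> ({..x1} \<times> UNIV)" for x1
    unfolding marginal1_def using tendsto_Lim[OF _ tendsto_marginals(1)[OF \<mu> F]] by simp
  have m2: "marginal2 F x2 = measure \<mu> (UNIV \<times> {..x2})" for x2
    unfolding marginal2_def using tendsto_Lim[OF _ tendsto_marginals(2)[OF \<mu> F]] by simp
  show "0 \<le> F x1 x2" "F x1 x2 \<le> marginal1 F x1" "F x1 x2 \<le> marginal2 F x2"
    "marginal1 F x1 \<le> 1" "marginal2 F x2 \<le> 1"
    unfolding m1 m2 F by (auto intro!: finite_measure_mono cl closed_Times)
  show "((\<lambda>x2. F x1 x2) \<longlongrightarrow> marginal1 F x1) at_top"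
    "((\<lambda>x1. F x1 x2) \<longlongrightarrow> marginal2 F x2) at_top"
    unfolding m1 m2 by (rule tendsto_marginals[OF \<mu> F])+
  have m: "fst \<in> measurable \<mu> borel" "snd \<in> measurable \<mu> borel"
    unfolding measurable_cong_sets[OF \<mu>(2) refl]
    by (auto intro!: borel_measurable_continuous_onI continuous_intros)
  interpret d1: real_distribution "distr \<mu> borel fst"
    using m by (simp add: real_distribution_def real_distribution_axioms_def prob_space_distr)
  interpret d2: real_distribution "distr \<mu> borel snd"
    using m by (simp add: real_distribution_def real_distribution_axioms_def prob_space_distr)
  show "(marginal1 F \<longlongrightarrow> 1) at_top" "(marginal2 F \<longlongrightarrow> 1) at_top"
    unfolding marginal_eq_cdf[OF \<mu> F] by (rule d1.cdf_lim_at_top_prob d2.cdf_lim_at_top_prob)+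
qed

lemma maxconv_denominator_pos:
  assumes "is_bivariate_df F" "is_bivariate_df G" "F x1 x2 > 0" "G x1 x2 > 0"
    "marginal1 F x1 + marginal1 G x1 - 1 > 0"
  shows "marginal1 F x1 * marginal2 F x2 / F x1 x2 +
         marginal1 G x1 * marginal2 G x2 / G x1 x2 - 1 > 0"
proof -
  have "marginal1 K x1 \<le> marginal1 K x1 * marginal2 K x2 / K x1 x2"
    if "is_bivariate_df K" "K x1 x2 > 0" for K
    using bivariate_df_facts(2)[OF that(1), of x1 x2] bivariate_df_facts(3)[OF that(1), of x1 x2] that(2)
    by (auto simp: pos_le_divide_eq intro!: mult_left_mono)
  from this[OF assms(1,3)] this[OF assms(2,4)] assms(5) show ?thesis by linarith
qed

lemma marginal_bifree_maxconv:
  assumes F: "is_bivariate_df F" and G: "is_bivariate_df G"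
  shows "marginal1 (F \<star> G) x1 = max 0 (marginal1 F x1 + marginal1 G x1 - 1)"
    and "marginal2 (F \<star> G) x2 = max 0 (marginal2 F x2 + marginal2 G x2 - 1)"
proof -
  note fF = bivariate_df_facts[OF F] and fG = bivariate_df_facts[OF G]
  have "((\<lambda>x2. (F \<star> G) x1 x2) \<longlongrightarrow> max 0 (marginal1 F x1 + marginal1 G x1 - 1)) at_top"
  proof (cases "marginal1 F x1 + marginal1 G x1 - 1 > 0")
    case True
    let ?f = "marginal1 F x1" and ?g = "marginal1 G x1"
    have pos: "?f > 0" "?g > 0" using True fF(4)[of x1] fG(4)[of x1] by linarith+
    have l2: "((\<lambda>x2. marginal2 F x2 + marginal2 G x2 - 1) \<longlongrightarrow> 1 + 1 - 1) at_top"
      by (intro tendsto_intros fF fG)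
    have "\<forall>\<^sub>F x2 in at_top. F x1 x2 > 0" "\<forall>\<^sub>F x2 in at_top. G x1 x2 > 0"
      "\<forall>\<^sub>F x2 in at_top. marginal2 F x2 + marginal2 G x2 - 1 > 0"
      using order_tendstoD(1)[OF fF(6)[of x1] pos(1)] order_tendstoD(1)[OF fG(6)[of x1] pos(2)]
        order_tendstoD(1)[OF l2, of 0] by simp_all
    then have "\<forall>\<^sub>F x2 in at_top. (?f + ?g - 1) * (marginal2 F x2 + marginal2 G x2 - 1) /
        (?f * marginal2 F x2 / F x1 x2 + ?g * marginal2 G x2 / G x1 x2 - 1) = (F \<star> G) x1 x2"
      by eventually_elim (use True in \<open>auto simp: bifree_maxconv_def Let_def max_def\<close>)
    moreover have "((\<lambda>x2. (?f + ?g - 1) * (marginal2 F x2 + marginal2 G x2 - 1) /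
        (?f * marginal2 F x2 / F x1 x2 + ?g * marginal2 G x2 / G x1 x2 - 1)) \<longlongrightarrow>
        (?f + ?g - 1) * (1 + 1 - 1) / (?f * 1 / ?f + ?g * 1 / ?g - 1)) at_top"
      using pos by (intro tendsto_intros fF fG) auto
    ultimately show ?thesis
      using True pos by (auto dest: Lim_transform_eventually simp: max_def)
  qed (simp add: bifree_maxconv_def Let_def max_def)
  then show "marginal1 (F \<star> G) x1 = max 0 (marginal1 F x1 + marginal1 G x1 - 1)"
    unfolding marginal1_def[of "F \<star> G"] by (intro tendsto_Lim) auto
  have "((\<lambda>x1. (F \<star> G) x1 x2) \<longlongrightarrow> max 0 (marginal2 F x2 + marginal2 G x2 - 1)) at_top"
  proof (cases "marginal2 F x2 + marginal2 G x2 - 1 > 0")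
    case True
    let ?f = "marginal2 F x2" and ?g = "marginal2 G x2"
    have pos: "?f > 0" "?g > 0" using True fF(5)[of x2] fG(5)[of x2] by linarith+
    have l2: "((\<lambda>x1. marginal1 F x1 + marginal1 G x1 - 1) \<longlongrightarrow> 1 + 1 - 1) at_top"
      by (intro tendsto_intros fF fG)
    have "\<forall>\<^sub>F x1 in at_top. F x1 x2 > 0" "\<forall>\<^sub>F x1 in at_top. G x1 x2 > 0"
      "\<forall>\<^sub>F x1 in at_top. marginal1 F x1 + marginal1 G x1 - 1 > 0"
      using order_tendstoD(1)[OF fF(7)[of x2] pos(1)] order_tendstoD(1)[OF fG(7)[of x2] pos(2)]
        order_tendstoD(1)[OF l2, of 0] by simp_all
    then have "\<forall>\<^sub>F x1 in at_top. (marginal1 F x1 + marginal1 G x1 - 1) * (?f + ?g - 1) /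
        (marginal1 F x1 * ?f / F x1 x2 + marginal1 G x1 * ?g / G x1 x2 - 1) = (F \<star> G) x1 x2"
      by eventually_elim (use True in \<open>auto simp: bifree_maxconv_def Let_def max_def\<close>)
    moreover have "((\<lambda>x1. (marginal1 F x1 + marginal1 G x1 - 1) * (?f + ?g - 1) /
        (marginal1 F x1 * ?f / F x1 x2 + marginal1 G x1 * ?g / G x1 x2 - 1)) \<longlongrightarrow>
        (1 + 1 - 1) * (?f + ?g - 1) / (1 * ?f / ?f + 1 * ?g / ?g - 1)) at_top"
      using pos by (intro tendsto_intros fF fG) auto
    ultimately show ?thesis
      using True pos by (auto dest: Lim_transform_eventually simp: max_def)
  qed (simp add: bifree_maxconv_def Let_def max_def)
  then show "marginal2 (F \<star> G) x2 = max 0 (marginal2 F x2 + marginal2 G x2 - 1)"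
    unfolding marginal2_def[of "F \<star> G"] by (intro tendsto_Lim) auto
qed

lemma maxconv_relation_iff:
  assumes F: "is_bivariate_df F" and G: "is_bivariate_df G"
  shows "maxconv_relation F G H \<longleftrightarrow> H = F \<star> G"
proof
  assume H: "maxconv_relation F G H"
  have "H x1 x2 = (F \<star> G) x1 x2" for x1 x2
  proof (cases "F x1 x2 > 0 \<and> G x1 x2 > 0 \<and> marginal1 H x1 > 0 \<and> marginal2 H x2 > 0")
    case True
    define K where "K = marginal1 F x1 * marginal2 F x2 / F x1 x2 +
      marginal1 G x1 * marginal2 G x2 / G x1 x2 - 1"
    have h: "marginal1 H x1 = max 0 (marginal1 F x1 + marginal1 G x1 - 1)"
      "marginal2 H x2 = max 0 (marginal2 F x2 + marginal2 G x2 - 1)"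
      using H unfolding maxconv_relation_def by auto
    have e: "marginal1 H x1 * marginal2 H x2 / H x1 x2 = K"
      using H True unfolding maxconv_relation_def K_def by meson
    have "marginal1 F x1 + marginal1 G x1 - 1 > 0" using True h(1) by linarith
    then have "K > 0" using maxconv_denominator_pos[OF F G, of x1 x2] True by (simp add: K_def)
    then have "H x1 x2 = marginal1 H x1 * marginal2 H x2 / K"
      using e by (cases "H x1 x2 = 0") (auto simp: field_simps)
    then show ?thesis
      using True unfolding bifree_maxconv_def Let_def h(1,2) K_def by simp
  next
    case False
    then have "H x1 x2 = 0" using H unfolding maxconv_relation_def by auto
    then show ?thesis
      using False H unfolding maxconv_relation_def bifree_maxconv_def Let_def by auto
  qed
  then show "H = F \<star> G" by blast
next
  assume "H = F \<star> G"
  then show "maxconv_relation F G H"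
    unfolding maxconv_relation_def
    using marginal_bifree_maxconv[OF F G]
    by (auto simp: bifree_maxconv_def Let_def)
qed

text \<open>The \<open>n\<close>-fold convolution of \<open>F\<close> with itself, for \<open>n \<ge> 1\<close>.\<close>

definition bifree_maxpow :: "(real \<Rightarrow> real \<Rightarrow> real) \<Rightarrow> nat \<Rightarrow> real \<Rightarrow> real \<Rightarrow> real" where
  "bifree_maxpow F n = ((\<lambda>K. K \<star> F) ^^ (n - 1)) F"

section \<open>Domains of attraction\<close>

definition bifree_max_domain :: "(real \<Rightarrow> real \<Rightarrow> real) \<Rightarrow> (real \<Rightarrow> real \<Rightarrow> real) set" where
  "bifree_max_domain F = {H. is_bivariate_df H \<and>
     (\<exists>a b c d :: nat \<Rightarrow> real. (\<forall>n. a n > 0 \<and> c n > 0) \<and>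
        weak_conv2 (\<lambda>n x1 x2. bifree_maxpow H n (a n * x1 + b n) (c n * x2 + d n)) F)}"

definition classical_max_domain :: "(real \<Rightarrow> real \<Rightarrow> real) \<Rightarrow> (real \<Rightarrow> real \<Rightarrow> real) set" where
  "classical_max_domain G = {H. is_bivariate_df H \<and>
     (\<exists>a b c d :: nat \<Rightarrow> real. (\<forall>n. a n > 0 \<and> c n > 0) \<and>
        weak_conv2 (\<lambda>n x1 x2. H (a n * x1 + b n) (c n * x2 + d n) ^ n) G)}"

section \<open>Extreme value distributions and Pickands dependence functions\<close>

definition gev_df :: "real \<Rightarrow> real \<Rightarrow> real \<Rightarrow> real \<Rightarrow> real" where
  "gev_df \<xi> m \<sigma> x =
     (let s = (x - m) / \<sigma> in
      if \<xi> = 0 then exp (- exp (- s))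
      else if 1 + \<xi> * s > 0 then exp (- ((1 + \<xi> * s) powr (- 1 / \<xi>)))
      else if \<xi> > 0 then 0 else 1)"

definition is_extreme_value_df :: "(real \<Rightarrow> real) \<Rightarrow> bool" where
  "is_extreme_value_df G \<longleftrightarrow> (\<exists>\<xi> m \<sigma>. \<sigma> > 0 \<and> G = gev_df \<xi> m \<sigma>)"

definition segment2 :: "(real \<times> real) set" where
  "segment2 = {(x, y). 0 \<le> x \<and> x \<le> 1 \<and> 0 \<le> y \<and> y \<le> 1 \<and> x + y = 1}"

definition is_pickands :: "(real \<Rightarrow> real) \<Rightarrow> bool" where
  "is_pickands A \<longleftrightarrow> A ` {0..1} \<subseteq> {1/2..1} \<and>
     (\<exists>\<rho> :: (real \<times> real) measure.
        sets \<rho> = sets (restrict_space borel segment2) \<and> finite_measure \<rho> \<and>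
        (LINT p|\<rho>. fst p) = 1 \<and> (LINT p|\<rho>. snd p) = 1 \<and>
        (\<forall>t\<in>{0..1}. A t = (LINT p|\<rho>. max (t * fst p) ((1 - t) * snd p))))"

text \<open>\<open>(1 + log c)\<^sub>+\<close>; a case distinction is needed because \<open>ln 0 = 0\<close>.\<close>

definition pos_one_plus_ln :: "real \<Rightarrow> real" where
  "pos_one_plus_ln c = (if c \<le> 0 then 0 else max 0 (1 + ln c))"

definition bivariate_evd ::
  "(real \<Rightarrow> real) \<Rightarrow> (real \<Rightarrow> real) \<Rightarrow> (real \<Rightarrow> real) \<Rightarrow> real \<Rightarrow> real \<Rightarrow> real" where
  "bivariate_evd A G1 G2 x1 x2 =
     (if G1 x1 > 0 \<and> G2 x2 > 0 then
        if G1 x1 = 1 \<and> G2 x2 = 1 then 1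
        else exp ((ln (G1 x1) + ln (G2 x2)) * A (ln (G1 x1) / (ln (G1 x1) + ln (G2 x2))))
      else 0)"

text \<open>The copula on the closed unit square; outside the open square its values are the
  boundary values of a copula.\<close>

definition bifree_copula :: "(real \<Rightarrow> real) \<Rightarrow> real \<Rightarrow> real \<Rightarrow> real" where
  "bifree_copula A u v =
     (if u = 0 \<or> v = 0 then 0
      else if u = 1 then v
      else if v = 1 then u
      else u * v / (- 1 + u + v + (2 - u - v) * A ((1 - u) / (2 - u - v))))"

end

theory Submission
  imports Defs
begin

text \<open>
Everything is governed by the function \<open>l(p, q) = (p + q) A(p / (p + q))\<close>, which is the integral of
\<open>max (p x) (q y)\<close> against the spectral measure. With \<open>p = - log G1\<close> and \<open>q = - log G2\<close> one has
\<open>G = exp (- l(p, q))\<close>, and where \<open>F1 = 1 - p\<close> and \<open>F2 = 1 - q\<close> are positive,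
\<open>F = F1 F2 / (1 - p - q + l(p, q))\<close>. Both limits are continuous, so weak convergence means
convergence at every point.

Write \<open>u, v, h\<close> for the normalized marginals and values of \<open>H\<close> at index \<open>n\<close>. The classical power
\<open>h ^ n\<close> differs from \<open>exp (- n (1 - h))\<close> by \<open>O(1 / n)\<close> (lemma \<open>exp_power_diff\<close>), while solving the
recursion for the bi-free power gives the closed form
\<open>(1 - n (1 - u)) (1 - n (1 - v)) / (1 + n (u v / h - 1))\<close>, or \<open>0\<close> as soon as one of \<open>h\<close> and the two
factors of the numerator is not positive (lemma \<open>bifree_maxpow_eq_maxpow_value\<close>).
If \<open>n (1 - u), n (1 - v), n (1 - h)\<close> tend to \<open>p, q, r\<close> with \<open>p, q < 1\<close>, then \<open>n (u v / h - 1)\<close> tends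
to \<open>r - p - q\<close>, so the closed form tends to \<open>(1 - p) (1 - q) / (1 - p - q + r)\<close>; conversely \<open>r\<close> can be
read off from this limit. Convergence of the marginals follows in both settings from the Frechet
bounds (lemma \<open>marginal_tendsto\<close>). This settles the direction from \<open>G\<close> to \<open>F\<close>, and the converse
on the region where \<open>F1\<close> and \<open>F2\<close> are positive, that is, \<open>G1, G2 > 1 / e\<close>.

The remaining difficulty is that \<open>F\<close> forgets \<open>G\<close> outside that region. It is recovered from
max-stability: \<open>G\<close> at \<open>(\<alpha> y1 + \<beta>, \<gamma> y2 + \<delta>)\<close> equals the \<open>k\<close>-th power of \<open>G\<close> at \<open>(y1, y2)\<close>, and for
large \<open>k\<close> every point with \<open>G1, G2 > 0\<close> has the form on the left with \<open>(y1, y2)\<close> inside the region.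
Comparing the normalizations at the indices \<open>n\<close> and \<open>n div k\<close>, a convergence of types argument
(lemma \<open>affine_change_tendsto\<close>) shows that they differ in the limit by exactly this affine map, which
carries the convergence over (lemma \<open>bivariate_evd_domain_extends\<close>).
\<close>

section \<open>The stable tail dependence function\<close>

text \<open>
Unlike \<open>A\<close>, this is homogeneous and is given by one integral on the whole quadrant. At the origin
the formula reads \<open>0 * A 0 = 0\<close>, the correct value there.
\<close>

definition tail_dependence :: "(real \<Rightarrow> real) \<Rightarrow> real \<Rightarrow> real \<Rightarrow> real" where
  "tail_dependence A p q = (p + q) * A (p / (p + q))"

text \<open>
Bounds and continuity of the tail dependence function are read off from its integral
representation; multiplying the integrand of \<open>A (p / (p + q))\<close> by \<open>p + q\<close> clears the denominators.
\<close>

lemma tail_dependence_integral: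
  assumes "is_pickands A"
  obtains \<rho> :: "(real \<times> real) measure" where
    "integrable \<rho> fst" "integrable \<rho> snd" "(LINT z|\<rho>. fst z) = 1" "(LINT z|\<rho>. snd z) = 1"
    "\<And>z. z \<in> space \<rho> \<Longrightarrow> 0 \<le> fst z \<and> 0 \<le> snd z"
    "\<And>p q. integrable \<rho> (\<lambda>z. max (p * fst z) (q * snd z))"
    "\<And>p q. 0 \<le> p \<Longrightarrow> 0 \<le> q \<Longrightarrow>
       tail_dependence A p q = (LINT z|\<rho>. max (p * fst z) (q * snd z))"
proof -
  obtain \<rho> :: "(real \<times> real) measure" where
    sets: "sets \<rho> = sets (restrict_space borel segment2)" and fin: "finite_measure \<rho>"
    and one: "(LINT z|\<rho>. fst z) = 1" "(LINT z|\<rho>. snd z) = 1"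
    and A: "\<And>t. t \<in> {0..1} \<Longrightarrow> A t = (LINT z|\<rho>. max (t * fst z) ((1 - t) * snd z))"
    using assms unfolding is_pickands_def by blast
  interpret finite_measure \<rho> by fact
  have sp: "space \<rho> = segment2"
    using sets_eq_imp_space_eq[OF sets] by (simp add: space_restrict_space)
  have meas: "fst \<in> borel_measurable \<rho>" "snd \<in> borel_measurable \<rho>"
    unfolding measurable_cong_sets[OF sets refl]
    by (intro measurable_restrict_space1 borel_measurable_continuous_onI continuous_intros)+
  have int: "integrable \<rho> fst" "integrable \<rho> snd"
    by (rule integrable_const_bound[where B = 1]; use meas in \<open>auto simp: sp segment2_def\<close>)+
  have intmax: "integrable \<rho> (\<lambda>z. max (p * fst z) (q * snd z))" for p q
    by (intro integrable_max integrable_mult_right int)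
  show ?thesis
  proof (rule that[OF int one])
    show "0 \<le> fst z \<and> 0 \<le> snd z" if "z \<in> space \<rho>" for z
      using that by (auto simp: sp segment2_def)
    show "integrable \<rho> (\<lambda>z. max (p * fst z) (q * snd z))" for p q by (rule intmax)
    show "tail_dependence A p q = (LINT z|\<rho>. max (p * fst z) (q * snd z))"
      if pq: "0 \<le> p" "0 \<le> q" for p q
    proof (cases "p + q = 0")
      case True
      then show ?thesis using pq by (simp add: tail_dependence_def add_nonneg_eq_0_iff)
    next
      case False
      then have s: "p + q > 0" using pq by linarith
      have t: "p / (p + q) \<in> {0..1}" "1 - p / (p + q) = q / (p + q)"
        using s pq by (auto simp: field_simps)
      have "(p + q) * max (p / (p + q) * x) (q / (p + q) * y) = max (p * x) (q * y)" for x y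
        using s by (subst max_mult_distrib_left) auto
      then show ?thesis
        unfolding tail_dependence_def A[OF t(1)] t(2)
        by (simp flip: integral_mult_right_zero)
    qed
  qed
qed

lemma tail_dependence_bounds:
  assumes "is_pickands A" and pq: "0 \<le> p" "0 \<le> q"
  shows "p \<le> tail_dependence A p q" "q \<le> tail_dependence A p q" "tail_dependence A p q \<le> p + q"
proof -
  obtain \<rho> :: "(real \<times> real) measure" where \<rho>: 
    "integrable \<rho> fst" "integrable \<rho> snd" "(LINT z|\<rho>. fst z) = 1" "(LINT z|\<rho>. snd z) = 1"
    "\<And>z. z \<in> space \<rho> \<Longrightarrow> 0 \<le> fst z \<and> 0 \<le> snd z"
    "\<And>p q. integrable \<rho> (\<lambda>z. max (p * fst z) (q * snd z))"
    "\<And>p q. 0 \<le> p \<Longrightarrow> 0 \<le> q \<Longrightarrow>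
       tail_dependence A p q = (LINT z|\<rho>. max (p * fst z) (q * snd z))"
    by (rule tail_dependence_integral[OF assms(1)]) blast
  have "(LINT z|\<rho>. p * fst z) \<le> tail_dependence A p q"
    "(LINT z|\<rho>. q * snd z) \<le> tail_dependence A p q"
    unfolding \<rho>(7)[OF pq] by (intro integral_mono \<rho>(6) integrable_mult_right \<rho>(1,2); simp)+
  then show "p \<le> tail_dependence A p q" "q \<le> tail_dependence A p q"
    using \<rho>(3,4) by simp_all
  have "tail_dependence A p q \<le> (LINT z|\<rho>. p * fst z + q * snd z)"
    unfolding \<rho>(7)[OF pq]
    by (intro integral_mono \<rho>(6) integrable_mult_right \<rho>(1,2) Bochner_Integration.integrable_add)
       (use pq \<rho>(5) in auto)
  also have "\<dots> = p + q" using \<rho>(1-4) by simp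
  finally show "tail_dependence A p q \<le> p + q" .
qed

text \<open>
The integrand changes by at most \<open>\<bar>p - p'\<bar> x + \<bar>q - q'\<bar> y\<close>, and \<open>x\<close> and \<open>y\<close> have integral \<open>1\<close>.
\<close>

lemma tail_dependence_lipschitz:
  assumes "is_pickands A" and pq: "0 \<le> p" "0 \<le> q" "0 \<le> p'" "0 \<le> q'"
  shows "\<bar>tail_dependence A p q - tail_dependence A p' q'\<bar> \<le> \<bar>p - p'\<bar> + \<bar>q - q'\<bar>"
proof -
  obtain \<rho> :: "(real \<times> real) measure" where \<rho>: 
    "integrable \<rho> fst" "integrable \<rho> snd" "(LINT z|\<rho>. fst z) = 1" "(LINT z|\<rho>. snd z) = 1"
    "\<And>z. z \<in> space \<rho> \<Longrightarrow> 0 \<le> fst z \<and> 0 \<le> snd z"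
    "\<And>p q. integrable \<rho> (\<lambda>z. max (p * fst z) (q * snd z))"
    "\<And>p q. 0 \<le> p \<Longrightarrow> 0 \<le> q \<Longrightarrow>
       tail_dependence A p q = (LINT z|\<rho>. max (p * fst z) (q * snd z))"
    by (rule tail_dependence_integral[OF assms(1)]) blast
  have one_sided: "tail_dependence A p q \<le> tail_dependence A p' q' + (\<bar>p - p'\<bar> + \<bar>q - q'\<bar>)"
    if pq: "0 \<le> p" "0 \<le> q" "0 \<le> p'" "0 \<le> q'" for p q p' q'
  proof -
    have "tail_dependence A p q \<le>
      (LINT z|\<rho>. max (p' * fst z) (q' * snd z) + (\<bar>p - p'\<bar> * fst z + \<bar>q - q'\<bar> * snd z))"
      unfolding \<rho>(7)[OF pq(1,2)]
    proof (intro integral_mono \<rho>(6) integrable_mult_right \<rho>(1,2) Bochner_Integration.integrable_add)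
      fix z assume "z \<in> space \<rho>"
      then have z: "0 \<le> fst z" "0 \<le> snd z" using \<rho>(5) by auto
      have "p * fst z \<le> p' * fst z + \<bar>p - p'\<bar> * fst z" "q * snd z \<le> q' * snd z + \<bar>q - q'\<bar> * snd z"
        using z by (auto simp flip: distrib_right intro!: mult_right_mono)
      moreover have "0 \<le> \<bar>p - p'\<bar> * fst z" "0 \<le> \<bar>q - q'\<bar> * snd z" using z by simp_all
      ultimately show "max (p * fst z) (q * snd z) \<le>
          max (p' * fst z) (q' * snd z) + (\<bar>p - p'\<bar> * fst z + \<bar>q - q'\<bar> * snd z)"
        by linarith
    qed
    also have "\<dots> = tail_dependence A p' q' + (\<bar>p - p'\<bar> + \<bar>q - q'\<bar>)"
      using \<rho>(1-4,6) unfolding \<rho>(7)[OF pq(3,4)] by simp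
    finally show ?thesis .
  qed
  show ?thesis
    using one_sided[OF pq] one_sided[OF pq(3,4,1,2)] by (auto simp: abs_minus_commute)
qed

lemma tendsto_tail_dependence:
  assumes A: "is_pickands A" and "(f \<longlongrightarrow> p) M" "(g \<longlongrightarrow> q) M" "0 \<le> p" "0 \<le> q"
    and "\<forall>\<^sub>F x in M. 0 \<le> f x" "\<forall>\<^sub>F x in M. 0 \<le> g x"
  shows "((\<lambda>x. tail_dependence A (f x) (g x)) \<longlongrightarrow> tail_dependence A p q) M"
proof -
  have "((\<lambda>x. \<bar>f x - p\<bar> + \<bar>g x - q\<bar>) \<longlongrightarrow> \<bar>p - p\<bar> + \<bar>q - q\<bar>) M"
    using assms by (intro tendsto_intros)
  then have lim: "((\<lambda>x. \<bar>f x - p\<bar> + \<bar>g x - q\<bar>) \<longlongrightarrow> 0) M" by simp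
  show ?thesis
  proof (rule LIM_zero_cancel, rule Lim_null_comparison[OF _ lim])
    show "\<forall>\<^sub>F x in M. norm (tail_dependence A (f x) (g x) - tail_dependence A p q)
        \<le> \<bar>f x - p\<bar> + \<bar>g x - q\<bar>"
      using assms(6,7) by eventually_elim (simp add: tail_dependence_lipschitz[OF A] assms(4,5))
  qed
qed

lemma tail_dependence_scale:
  assumes "k \<noteq> 0"
  shows "tail_dependence A (k * p) (k * q) = k * tail_dependence A p q"
  using assms by (simp add: tail_dependence_def flip: distrib_left)

text \<open>
The case \<open>G1 x1 = G2 x2 = 1\<close> merges with the general one, because the tail dependence function
vanishes at the origin.
\<close>

lemma bivariate_evd_eq:
  "bivariate_evd A G1 G2 x1 x2 =
     (if G1 x1 > 0 \<and> G2 x2 > 0 then exp (- tail_dependence A (- ln (G1 x1)) (- ln (G2 x2))) else 0)"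
proof -
  have "(- a) / (- a + - b) = a / (a + b)" for a b :: real
    by (metis minus_add_distrib minus_divide_divide)
  then show ?thesis
    by (simp add: bivariate_evd_def tail_dependence_def algebra_simps)
qed

text \<open>
The prescribed values on the sides \<open>u = 1\<close> and \<open>v = 1\<close> are instances of the formula for the open
square, since \<open>tail_dependence A 0 q = q\<close> and \<open>tail_dependence A p 0 = p\<close>.
\<close>

lemma bifree_copula_eq:
  assumes A: "is_pickands A" and uv: "0 \<le> u" "u \<le> 1" "0 \<le> v" "v \<le> 1"
  shows "bifree_copula A u v =
    (if 0 < u \<and> 0 < v then u * v / (u + v - 1 + tail_dependence A (1 - u) (1 - v)) else 0)"
proof -
  have "tail_dependence A 0 (1 - v) = 1 - v" "tail_dependence A (1 - u) 0 = 1 - u"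
    using tail_dependence_bounds[OF A, of 0 "1 - v"] tail_dependence_bounds[OF A, of "1 - u" 0] uv
    by auto
  then show ?thesis
    using uv by (auto simp: bifree_copula_def tail_dependence_def algebra_simps)
qed

text \<open>
These are the inequalities \<open>max p q \<le> tail_dependence A p q \<le> p + q\<close> for \<open>p = 1 - u\<close> and
\<open>q = 1 - v\<close>. They keep the denominator positive and make the copula dominate the product copula.
\<close>

lemma bifree_copula_denominator:
  assumes A: "is_pickands A" and uv: "u \<le> 1" "v \<le> 1"
  shows "u \<le> u + v - 1 + tail_dependence A (1 - u) (1 - v)"
    "v \<le> u + v - 1 + tail_dependence A (1 - u) (1 - v)"
    "u + v - 1 + tail_dependence A (1 - u) (1 - v) \<le> 1"
  using tail_dependence_bounds[OF A, of "1 - u" "1 - v"] uv by auto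

lemma bifree_copula_bounds:
  assumes A: "is_pickands A" and uv: "0 \<le> u" "u \<le> 1" "0 \<le> v" "v \<le> 1"
  shows "u * v \<le> bifree_copula A u v" "bifree_copula A u v \<le> u" "bifree_copula A u v \<le> v"
proof -
  define D where "D = u + v - 1 + tail_dependence A (1 - u) (1 - v)"
  note D = bifree_copula_denominator[OF A uv(2,4), folded D_def]
  have eq: "bifree_copula A u v = (if 0 < u \<and> 0 < v then u * v / D else 0)"
    unfolding D_def by (rule bifree_copula_eq[OF A uv])
  show "u * v \<le> bifree_copula A u v" "bifree_copula A u v \<le> u" "bifree_copula A u v \<le> v"
    using D uv unfolding eq by (auto simp: field_simps mult_left_mono)
qed

lemma bivariate_evd_bounds:
  assumes A: "is_pickands A" and g: "0 \<le> G1 x1" "G1 x1 \<le> 1" "0 \<le> G2 x2" "G2 x2 \<le> 1"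
  shows "G1 x1 * G2 x2 \<le> bivariate_evd A G1 G2 x1 x2"
    "bivariate_evd A G1 G2 x1 x2 \<le> G1 x1" "bivariate_evd A G1 G2 x1 x2 \<le> G2 x2"
proof -
  have "G1 x1 * G2 x2 \<le> bivariate_evd A G1 G2 x1 x2 \<and> bivariate_evd A G1 G2 x1 x2 \<le> G1 x1 \<and>
     bivariate_evd A G1 G2 x1 x2 \<le> G2 x2"
  proof (cases "0 < G1 x1 \<and> 0 < G2 x2")
    case True
    then have le: "0 \<le> - ln (G1 x1)" "0 \<le> - ln (G2 x2)" using g by auto
    have "exp (ln (G1 x1)) = G1 x1" "exp (ln (G2 x2)) = G2 x2" 
      "exp (ln (G1 x1) + ln (G2 x2)) = G1 x1 * G2 x2" using True by (auto simp: exp_add)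
    then show ?thesis
      using tail_dependence_bounds[OF A le] True unfolding bivariate_evd_eq
      by (smt (verit) exp_le_cancel_iff)
  qed (use g in \<open>auto simp: bivariate_evd_eq\<close>)
  then show "G1 x1 * G2 x2 \<le> bivariate_evd A G1 G2 x1 x2"
    "bivariate_evd A G1 G2 x1 x2 \<le> G1 x1" "bivariate_evd A G1 G2 x1 x2 \<le> G2 x2" by auto
qed

lemma tendsto_coordinates:
  assumes "isCont k x"
  shows "((\<lambda>y. k (fst y)) \<longlongrightarrow> k x) (at (x, z))" "((\<lambda>y. k (snd y)) \<longlongrightarrow> k x) (at (z, x))"
  using tendsto_fst[OF tendsto_ident_at[of "(x, z)" UNIV]]
    tendsto_snd[OF tendsto_ident_at[of "(z, x)" UNIV]]
  by (auto intro: isCont_tendsto_compose[OF assms])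

text \<open>
Both bivariate limits are given by a formula where the marginals are positive and by \<open>0\<close> elsewhere.
On the boundary between the two cases continuity holds because the values are squeezed below the
marginals.
\<close>

lemma isCont_of_positive_part:
  fixes K :: "real \<Rightarrow> real \<Rightarrow> real"
  assumes cont: "isCont k1 x1" "isCont k2 x2"
    and bounds: "\<And>y1 y2. 0 \<le> K y1 y2" "\<And>y1 y2. K y1 y2 \<le> k1 y1" "\<And>y1 y2. K y1 y2 \<le> k2 y2"
    and formula: "\<And>y1 y2. 0 < k1 y1 \<Longrightarrow> 0 < k2 y2 \<Longrightarrow> K y1 y2 = \<Phi> (k1 y1) (k2 y2)"
    and \<Phi>: "0 < k1 x1 \<Longrightarrow> 0 < k2 x2 \<Longrightarrow>
      ((\<lambda>y. \<Phi> (k1 (fst y)) (k2 (snd y))) \<longlongrightarrow> \<Phi> (k1 x1) (k2 x2)) (at (x1, x2))"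
  shows "isCont (\<lambda>(y1, y2). K y1 y2) (x1, x2)"
proof -
  have l1: "((\<lambda>y. k1 (fst y)) \<longlongrightarrow> k1 x1) (at (x1, x2))"
    and l2: "((\<lambda>y. k2 (snd y)) \<longlongrightarrow> k2 x2) (at (x1, x2))"
    by (rule tendsto_coordinates[OF cont(1)] tendsto_coordinates[OF cont(2)])+
  have "((\<lambda>y. K (fst y) (snd y)) \<longlongrightarrow> K x1 x2) (at (x1, x2))"
  proof (cases "0 < k1 x1 \<and> 0 < k2 x2")
    case True
    have "\<forall>\<^sub>F y in at (x1, x2). \<Phi> (k1 (fst y)) (k2 (snd y)) = K (fst y) (snd y)"
      using order_tendstoD(1)[OF l1 conjunct1[OF True]] order_tendstoD(1)[OF l2 conjunct2[OF True]]
      by eventually_elim (simp add: formula)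
    with \<Phi> True show ?thesis by (simp add: formula Lim_transform_eventually)
  next
    case False
    have z: "K x1 x2 = 0"
      using False bounds(1,2,3)[of x1 x2] by linarith
    have "k1 x1 = 0 \<or> k2 x2 = 0"
      using False bounds(1,2,3)[of x1 x2] by linarith
    then show ?thesis
    proof
      assume "k1 x1 = 0"
      with l1 have "((\<lambda>y. k1 (fst y)) \<longlongrightarrow> 0) (at (x1, x2))" by simp
      then show ?thesis
        unfolding z by (rule tendsto_sandwich[OF _ _ tendsto_const, rotated 2]) (simp_all add: bounds)
    next
      assume "k2 x2 = 0"
      with l2 have "((\<lambda>y. k2 (snd y)) \<longlongrightarrow> 0) (at (x1, x2))" by simp
      then show ?thesis
        unfolding z by (rule tendsto_sandwich[OF _ _ tendsto_const, rotated 2]) (simp_all add: bounds)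
    qed
  qed
  then show ?thesis by (simp add: isCont_def split_def)
qed

lemma isCont_bivariate_evd:
  assumes A: "is_pickands A" and cont: "isCont G1 x1" "isCont G2 x2"
    and g: "\<And>x. 0 \<le> G1 x \<and> G1 x \<le> 1" "\<And>x. 0 \<le> G2 x \<and> G2 x \<le> 1"
  shows "isCont (\<lambda>(y1, y2). bivariate_evd A G1 G2 y1 y2) (x1, x2)"
proof (rule isCont_of_positive_part[OF cont, where \<Phi> = "\<lambda>u v. exp (- tail_dependence A (- ln u) (- ln v))"])
  have c: "((\<lambda>y. G1 (fst y)) \<longlongrightarrow> G1 x1) (at (x1, x2))" "((\<lambda>y. G2 (snd y)) \<longlongrightarrow> G2 x2) (at (x1, x2))"
    by (rule tendsto_coordinates[OF cont(1)] tendsto_coordinates[OF cont(2)])+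
  assume pos: "0 < G1 x1" "0 < G2 x2"
  have ev: "\<forall>\<^sub>F y in at (x1, x2). 0 < G1 (fst y)" "\<forall>\<^sub>F y in at (x1, x2). 0 < G2 (snd y)"
    using order_tendstoD(1)[OF c(1) pos(1)] order_tendstoD(1)[OF c(2) pos(2)] .
  have "((\<lambda>y. tail_dependence A (- ln (G1 (fst y))) (- ln (G2 (snd y)))) \<longlongrightarrow>
    tail_dependence A (- ln (G1 x1)) (- ln (G2 x2))) (at (x1, x2))"
  proof (rule tendsto_tail_dependence[OF A])
    show "\<forall>\<^sub>F y in at (x1, x2). 0 \<le> - ln (G1 (fst y))"
      using ev(1) by eventually_elim (use g(1) in auto)
    show "\<forall>\<^sub>F y in at (x1, x2). 0 \<le> - ln (G2 (snd y))"
      using ev(2) by eventually_elim (use g(2) in auto)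
  qed (use pos g in \<open>auto intro!: tendsto_intros c\<close>)
  then show "((\<lambda>y. exp (- tail_dependence A (- ln (G1 (fst y))) (- ln (G2 (snd y))))) \<longlongrightarrow>
    exp (- tail_dependence A (- ln (G1 x1)) (- ln (G2 x2)))) (at (x1, x2))"
    by (intro tendsto_intros)
next
  show "0 \<le> bivariate_evd A G1 G2 y1 y2" for y1 y2 by (simp add: bivariate_evd_eq)
  show "bivariate_evd A G1 G2 y1 y2 \<le> G1 y1" "bivariate_evd A G1 G2 y1 y2 \<le> G2 y2" for y1 y2
    using bivariate_evd_bounds(2,3)[OF A, of G1 y1 G2 y2] g by simp_all
next
  show "bivariate_evd A G1 G2 y1 y2 = exp (- tail_dependence A (- ln (G1 y1)) (- ln (G2 y2)))"
    if "0 < G1 y1" "0 < G2 y2" for y1 y2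
    using that by (simp only: bivariate_evd_eq simp_thms if_True)
qed

lemma isCont_bifree_copula:
  fixes F1 F2 :: "real \<Rightarrow> real"
  assumes A: "is_pickands A" and cont: "isCont F1 x1" "isCont F2 x2"
    and f: "\<And>x. 0 \<le> F1 x \<and> F1 x \<le> 1" "\<And>x. 0 \<le> F2 x \<and> F2 x \<le> 1"
  shows "isCont (\<lambda>(y1, y2). bifree_copula A (F1 y1) (F2 y2)) (x1, x2)"
proof (rule isCont_of_positive_part[OF cont,
    where \<Phi> = "\<lambda>u v. u * v / (u + v - 1 + tail_dependence A (1 - u) (1 - v))"])
  have c: "((\<lambda>y. F1 (fst y)) \<longlongrightarrow> F1 x1) (at (x1, x2))" "((\<lambda>y. F2 (snd y)) \<longlongrightarrow> F2 x2) (at (x1, x2))"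
    by (rule tendsto_coordinates[OF cont(1)] tendsto_coordinates[OF cont(2)])+
  assume pos: "0 < F1 x1" "0 < F2 x2"
  have "((\<lambda>y. tail_dependence A (1 - F1 (fst y)) (1 - F2 (snd y))) \<longlongrightarrow>
      tail_dependence A (1 - F1 x1) (1 - F2 x2)) (at (x1, x2))"
    by (rule tendsto_tail_dependence[OF A]) (use f in \<open>auto intro!: tendsto_intros c\<close>)
  moreover have "F1 x1 + F2 x2 - 1 + tail_dependence A (1 - F1 x1) (1 - F2 x2) \<noteq> 0"
    using bifree_copula_denominator(1)[OF A, of "F1 x1" "F2 x2"] f pos by (auto simp: not_less)
  ultimately show "((\<lambda>y. F1 (fst y) * F2 (snd y) / (F1 (fst y) + F2 (snd y) - 1 +
      tail_dependence A (1 - F1 (fst y)) (1 - F2 (snd y)))) \<longlongrightarrow>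
    F1 x1 * F2 x2 / (F1 x1 + F2 x2 - 1 + tail_dependence A (1 - F1 x1) (1 - F2 x2))) (at (x1, x2))"
    by (intro tendsto_intros c)
next
  fix y1 y2
  have b: "F1 y1 * F2 y2 \<le> bifree_copula A (F1 y1) (F2 y2)"
    "bifree_copula A (F1 y1) (F2 y2) \<le> F1 y1" "bifree_copula A (F1 y1) (F2 y2) \<le> F2 y2"
    using bifree_copula_bounds[OF A, of "F1 y1" "F2 y2"] f by simp_all
  have "0 \<le> F1 y1 * F2 y2" using f by simp
  with b show "0 \<le> bifree_copula A (F1 y1) (F2 y2)" "bifree_copula A (F1 y1) (F2 y2) \<le> F1 y1"
    "bifree_copula A (F1 y1) (F2 y2) \<le> F2 y2" by linarith+
  show "bifree_copula A (F1 y1) (F2 y2) =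
      F1 y1 * F2 y2 / (F1 y1 + F2 y2 - 1 + tail_dependence A (1 - F1 y1) (1 - F2 y2))"
    if "0 < F1 y1" "0 < F2 y2"
    using that f by (subst bifree_copula_eq[OF A]) auto
qed

section \<open>Max-stable univariate distribution functions\<close>

text \<open>
The properties of an extreme value distribution function on which the argument rests. Attaining all
values in \<open>(0, 1)\<close> replaces the limits at infinity and, together with monotonicity, continuity.
\<close>

locale max_stable_df =
  fixes g :: "real \<Rightarrow> real"
  assumes g_mono: "x \<le> y \<Longrightarrow> g x \<le> g y"
    and g_nonneg: "0 \<le> g x"
    and g_le_1: "g x \<le> 1"
    and g_surj: "0 < c \<Longrightarrow> c < 1 \<Longrightarrow> \<exists>x. g x = c"
    and g_strict: "x < y \<Longrightarrow> 0 < g x \<Longrightarrow> g x < 1 \<Longrightarrow> g x < g y"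
    and g_stable: "1 \<le> k \<Longrightarrow> \<exists>\<alpha>>0. \<exists>\<beta>. \<forall>y. g (\<alpha> * y + \<beta>) = g y ^ k"
begin

lemma g_less_imp: "g x < g y \<Longrightarrow> x < y"
  using g_mono[of y x] by (meson not_le)

lemma isCont_g: "isCont g x"
  unfolding isCont_def
proof (rule order_tendstoI)
  fix c assume c: "c < g x"
  show "\<forall>\<^sub>F y in at x. c < g y"
  proof (cases "c < 0")
    case True
    then show ?thesis using g_nonneg by (intro always_eventually) (meson less_le_trans)
  next
    case False
    then have "0 < (c + g x) / 2" "(c + g x) / 2 < 1" using c g_le_1[of x] by auto
    then obtain z where z: "g z = (c + g x) / 2" using g_surj by blast
    then have "z < x" "c < g z" using c g_less_imp[of z x] by auto
    then have "\<forall>\<^sub>F y in at x. z < y" by (intro order_tendstoD(1)[OF tendsto_ident_at])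
    then show ?thesis
      by eventually_elim (meson \<open>c < g z\<close> g_mono less_imp_le less_le_trans)
  qed
next
  fix c assume c: "g x < c"
  show "\<forall>\<^sub>F y in at x. g y < c"
  proof (cases "1 < c")
    case True
    then show ?thesis using g_le_1 by (intro always_eventually) (meson le_less_trans)
  next
    case False
    then have "0 < (c + g x) / 2" "(c + g x) / 2 < 1" using c g_nonneg[of x] by auto
    then obtain z where z: "g z = (c + g x) / 2" using g_surj by blast
    then have "x < z" "g z < c" using c g_less_imp[of x z] by auto
    then have "\<forall>\<^sub>F y in at x. y < z" by (intro order_tendstoD(2)[OF tendsto_ident_at])
    then show ?thesis
      by eventually_elim (meson \<open>g z < c\<close> g_mono less_imp_le le_less_trans)
  qed
qed

lemma g_at_top: "(g \<longlongrightarrow> 1) at_top"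
proof (rule order_tendstoI)
  fix c :: real assume "c < 1"
  then have "0 < (max c 0 + 1) / 2" "(max c 0 + 1) / 2 < 1" "c < (max c 0 + 1) / 2" by auto
  then obtain z where z: "c < g z" using g_surj by metis
  then show "\<forall>\<^sub>F y in at_top. c < g y"
    unfolding eventually_at_top_linorder using g_mono by (meson less_le_trans)
next
  fix c :: real assume "1 < c"
  then show "\<forall>\<^sub>F y in at_top. g y < c"
    using g_le_1 by (intro always_eventually) (meson le_less_trans)
qed

end

text \<open>
In the coordinate \<open>s = (x - m) / \<sigma>\<close>, stability holds because \<open>exp (- s)\<close> is multiplied by \<open>k\<close> under
the shift by \<open>- ln k\<close> if \<open>\<xi> = 0\<close>, and \<open>(1 + \<xi> s) powr (- 1 / \<xi>)\<close> is multiplied by \<open>k\<close> when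
\<open>1 + \<xi> s\<close> is scaled by \<open>k powr (- \<xi>)\<close> otherwise.
\<close>

lemma max_stable_gev_df:
  assumes "\<sigma> > 0"
  shows "max_stable_df (gev_df \<xi> m \<sigma>)"
proof (cases "\<xi> = 0")
  case True
  then have g: "gev_df \<xi> m \<sigma> x = exp (- exp (- ((x - m) / \<sigma>)))" for x
    by (simp add: gev_df_def)
  show ?thesis
    unfolding g max_stable_df_def
  proof (intro conjI allI impI)
    fix c :: real assume c: "0 < c" "c < 1"
    then show "\<exists>x. exp (- exp (- ((x - m) / \<sigma>))) = c"
      using assms by (intro exI[of _ "m - \<sigma> * ln (- ln c)"]) simp
  next
    fix k :: nat assume "1 \<le> k"
    then have "exp (- ((1 * y + (- \<sigma> * ln k) - m) / \<sigma>)) = k * exp (- ((y - m) / \<sigma>))" for y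
      using assms by (simp add: diff_divide_distrib exp_diff exp_minus exp_add)
    then have "exp (- exp (- ((1 * y + (- \<sigma> * ln k) - m) / \<sigma>))) = exp (- exp (- ((y - m) / \<sigma>))) ^ k" for y
      by (simp only: exp_of_nat_mult[symmetric]) simp
    then show "\<exists>\<alpha>>0. \<exists>\<beta>. \<forall>y. exp (- exp (- ((\<alpha> * y + \<beta> - m) / \<sigma>))) = exp (- exp (- ((y - m) / \<sigma>))) ^ k"
      by (meson zero_less_one)
  qed (use assms in \<open>auto simp: divide_right_mono divide_strict_right_mono\<close>)
next
  case False
  define w where "w x = 1 + \<xi> * ((x - m) / \<sigma>)" for x
  have g: "gev_df \<xi> m \<sigma> x =
      (if w x > 0 then exp (- (w x powr (- 1 / \<xi>))) else if \<xi> > 0 then 0 else 1)" for x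
    using False by (simp add: gev_df_def w_def)
  have w_mono: "w x < w y" if "x < y" "\<xi> > 0" for x y
    using that assms by (simp add: w_def divide_strict_right_mono)
  have w_anti: "w y < w x" if "x < y" "\<xi> < 0" for x y
    using that assms by (simp add: w_def divide_strict_right_mono)
  show ?thesis
    unfolding max_stable_df_def
  proof (intro conjI allI impI)
    have strict: "gev_df \<xi> m \<sigma> x < gev_df \<xi> m \<sigma> y"
      if "x < y" "0 < gev_df \<xi> m \<sigma> x" "gev_df \<xi> m \<sigma> x < 1" for x y
    proof (cases "\<xi> > 0")
      case True
      then have "0 < w x" "w x < w y" using that w_mono[of x y] by (auto simp: g split: if_splits)
      moreover from this True have "w y powr (- 1 / \<xi>) < w x powr (- 1 / \<xi>)"
        by (intro powr_less_mono2_neg) (auto simp: divide_neg_pos)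
      ultimately show ?thesis by (simp add: g)
    next
      case neg: False
      then have "0 < w x" "w y < w x" using that w_anti[of x y] False by (auto simp: g split: if_splits)
      moreover from this neg False have "w y powr (- 1 / \<xi>) < w x powr (- 1 / \<xi>)" if "w y > 0"
        using that by (intro powr_less_mono2) (auto simp: divide_neg_neg)
      ultimately show ?thesis using neg that by (auto simp: g)
    qed
    show "gev_df \<xi> m \<sigma> x < gev_df \<xi> m \<sigma> y"
      if "x < y" "0 < gev_df \<xi> m \<sigma> x" "gev_df \<xi> m \<sigma> x < 1" for x y by (rule strict[OF that])
    show nonneg: "0 \<le> gev_df \<xi> m \<sigma> x" and le1: "gev_df \<xi> m \<sigma> x \<le> 1" for x by (auto simp: g)
    show "gev_df \<xi> m \<sigma> x \<le> gev_df \<xi> m \<sigma> y" if xy: "x \<le> y" for x y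
    proof -
      have "gev_df \<xi> m \<sigma> y = 1" if one: "gev_df \<xi> m \<sigma> x = 1" "x < y"
      proof -
        have "\<xi> < 0" "w x \<le> 0" using one(1) False by (auto simp: g split: if_splits)
        then show ?thesis using w_anti[OF one(2)] by (simp add: g)
      qed
      then show ?thesis using strict[of x y] nonneg[of x] le1[of x] nonneg[of y] xy
        by fastforce
    qed
    show "\<exists>x. gev_df \<xi> m \<sigma> x = c" if c: "0 < c" "c < 1" for c
    proof -
      define x where "x = m + \<sigma> * ((- ln c) powr (- \<xi>) - 1) / \<xi>"
      have "w x = (- ln c) powr (- \<xi>)" using assms False by (simp add: w_def x_def)
      moreover have "- ln c > 0" using c by simp
      ultimately have "w x > 0" "w x powr (- 1 / \<xi>) = - ln c"
        using False by (auto simp: powr_powr)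
      then show ?thesis using c by (intro exI[of _ x]) (simp add: g)
    qed
    show "\<exists>\<alpha>>0. \<exists>\<beta>. \<forall>y. gev_df \<xi> m \<sigma> (\<alpha> * y + \<beta>) = gev_df \<xi> m \<sigma> y ^ k" if k: "1 \<le> k" for k :: nat
    proof -
      define \<alpha> where "\<alpha> = real k powr (- \<xi>)"
      define \<beta> where "\<beta> = m - \<alpha> * m + \<sigma> * (\<alpha> - 1) / \<xi>"
      have \<alpha>: "\<alpha> > 0" using k by (simp add: \<alpha>_def)
      have w: "w (\<alpha> * y + \<beta>) = \<alpha> * w y" for y
        using assms False by (simp add: w_def \<beta>_def field_simps)
      have "(\<alpha> * w y) powr (- 1 / \<xi>) = real k * w y powr (- 1 / \<xi>)" if "w y > 0" for y
        using k that \<alpha> False by (simp add: powr_mult \<alpha>_def powr_powr)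
      then have "gev_df \<xi> m \<sigma> (\<alpha> * y + \<beta>) = gev_df \<xi> m \<sigma> y ^ k" for y
        using \<alpha> k by (auto simp: g w zero_less_mult_iff simp flip: exp_of_nat_mult)
      with \<alpha> show ?thesis by blast
    qed
  qed
qed

section \<open>Bi-free convolution powers in closed form\<close>

lemma bivariate_df_mono:
  assumes "is_bivariate_df H" "x1 \<le> y1" "x2 \<le> y2"
  shows "H x1 x2 \<le> H y1 y2"
proof -
  obtain \<mu> where \<mu>: "prob_space \<mu>" "sets \<mu> = sets (borel :: (real \<times> real) measure)"
    and H: "\<And>x1 x2. H x1 x2 = measure \<mu> ({..x1} \<times> {..x2})"
    using assms(1) unfolding is_bivariate_df_def by blast
  interpret prob_space \<mu> by fact
  show ?thesis
    unfolding H using assms(2,3)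
    by (intro finite_measure_mono) (auto simp: \<mu>(2) intro!: borel_closed closed_Times)
qed

lemma marginal_mono:
  assumes "is_bivariate_df H" "x \<le> y"
  shows "marginal1 H x \<le> marginal1 H y" "marginal2 H x \<le> marginal2 H y"
  using bivariate_df_mono[OF assms(1)] assms(2)
  by (intro tendsto_le[OF _ bivariate_df_facts(6)[OF assms(1)] bivariate_df_facts(6)[OF assms(1)]]
      tendsto_le[OF _ bivariate_df_facts(7)[OF assms(1)] bivariate_df_facts(7)[OF assms(1)]]; simp)+

lemma bivariate_df_frechet_lower:
  assumes "is_bivariate_df H"
  shows "marginal1 H x1 + marginal2 H x2 - 1 \<le> H x1 x2"
proof -
  obtain \<mu> where \<mu>: "prob_space \<mu>" "sets \<mu> = sets (borel :: (real \<times> real) measure)"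
    and H: "\<And>x1 x2. H x1 x2 = measure \<mu> ({..x1} \<times> {..x2})"
    using assms(1) unfolding is_bivariate_df_def by blast
  interpret prob_space \<mu> by fact
  have cl: "A \<in> sets \<mu>" if "closed A" for A using that by (simp add: \<mu>(2) borel_closed)
  let ?A = "{..x1} \<times> (UNIV :: real set)" and ?B = "(UNIV :: real set) \<times> {..x2}"
  have m: "marginal1 H x1 = measure \<mu> ?A" "marginal2 H x2 = measure \<mu> ?B"
    using tendsto_Lim[OF _ tendsto_marginals(1)[OF \<mu> H]] tendsto_Lim[OF _ tendsto_marginals(2)[OF \<mu> H]]
    by (simp_all add: marginal1_def marginal2_def)
  have "?A \<in> sets \<mu>" "?B \<in> sets \<mu>" by (intro cl closed_Times; simp)+
  then have "measure \<mu> ?A + measure \<mu> ?B = measure \<mu> (?A \<union> ?B) + measure \<mu> (?A \<inter> ?B)"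
    using measure_Un3[of ?A \<mu> ?B] by (simp add: fmeasurable_eq_sets)
  moreover have "measure \<mu> (?A \<inter> ?B) = measure \<mu> ({..x1} \<times> {..x2})"
    by (rule arg_cong[of _ _ "measure \<mu>"]) auto
  ultimately show ?thesis unfolding m H using prob_le_1[of "?A \<union> ?B"] by linarith
qed

text \<open>
The value of the \<open>n\<close>-th bi-free power at a point where the marginals of the given distribution
function are \<open>u\<close> and \<open>v\<close> and its value is \<open>h\<close>: in the coordinates \<open>u\<close>, \<open>v\<close> and \<open>u v / h\<close> the
convolution is addition of the differences from \<open>1\<close>.
\<close>

definition maxpow_value :: "nat \<Rightarrow> real \<Rightarrow> real \<Rightarrow> real \<Rightarrow> real" where
  "maxpow_value n u v h =
     (if 0 < h \<and> 0 < 1 - n * (1 - u) \<and> 0 < 1 - n * (1 - v)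
      then (1 - n * (1 - u)) * (1 - n * (1 - v)) / (1 + n * (u * v / h - 1)) else 0)"

lemma maxpow_denominator:
  assumes "0 < h" "h \<le> u" "h \<le> v"
  shows "1 - n * (1 - u) \<le> 1 + real n * (u * v / h - 1)"
    "1 - n * (1 - v) \<le> 1 + real n * (u * v / h - 1)"
proof -
  have "u \<le> u * v / h" "v \<le> u * v / h"
    using assms by (auto simp: pos_le_divide_eq mult_left_mono mult.commute)
  then have "real n * u \<le> n * (u * v / h)" "real n * v \<le> n * (u * v / h)"
    by (intro mult_left_mono; simp)+
  then show "1 - n * (1 - u) \<le> 1 + real n * (u * v / h - 1)"
    "1 - n * (1 - v) \<le> 1 + real n * (u * v / h - 1)"
    by (auto simp: algebra_simps)
qed

lemma maxpow_value_pos_iff: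
  assumes "0 \<le> h" "h \<le> u" "h \<le> v"
  shows "0 < maxpow_value n u v h \<longleftrightarrow> 0 < h \<and> 0 < 1 - n * (1 - u) \<and> 0 < 1 - n * (1 - v)"
  using maxpow_denominator(1)[of h u v n] assms
  by (auto simp: maxpow_value_def intro!: divide_pos_pos mult_pos_pos)

text \<open>
Frechet bounds for the bi-free power. The lower one is the substantial one. With \<open>p = n (1 - u)\<close>,
\<open>q = n (1 - v)\<close> and \<open>s = p + q < 1\<close>, the bound \<open>u + v - 1 = 1 - s / n \<le> h\<close> limits the denominator to
\<open>1 + p q / (n - s)\<close>. This is largest for \<open>n = 1\<close>, where it equals \<open>(1 - p) (1 - q) / (1 - s)\<close>.
\<close>

lemma maxpow_value_bounds:
  assumes h: "0 \<le> h" "h \<le> u" "h \<le> v" "u + v - 1 \<le> h" and uv: "u \<le> 1" "v \<le> 1" and n: "1 \<le> n"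
  shows "0 \<le> maxpow_value n u v h"
    "maxpow_value n u v h \<le> max 0 (1 - n * (1 - u))"
    "maxpow_value n u v h \<le> max 0 (1 - n * (1 - v))"
    "max 0 (1 - n * (1 - u)) + max 0 (1 - n * (1 - v)) - 1 \<le> maxpow_value n u v h"
proof -
  define p q D where "p = n * (1 - u)" and "q = n * (1 - v)" and "D = 1 + n * (u * v / h - 1)"
  have pq: "0 \<le> p" "0 \<le> q" using uv by (auto simp: p_def q_def)
  have val: "maxpow_value n u v h = (if 0 < h \<and> p < 1 \<and> q < 1 then (1 - p) * (1 - q) / D else 0)"
    unfolding maxpow_value_def p_def q_def D_def by simp
  have D: "1 - p \<le> D" "1 - q \<le> D" if "0 < h"
    unfolding p_def q_def D_def using maxpow_denominator[OF that h(2,3)] by auto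
  show nn: "0 \<le> maxpow_value n u v h"
    unfolding val using D by (auto intro!: divide_nonneg_nonneg mult_nonneg_nonneg)
  show "maxpow_value n u v h \<le> max 0 (1 - n * (1 - u))"
    "maxpow_value n u v h \<le> max 0 (1 - n * (1 - v))"
    unfolding val p_def[symmetric] q_def[symmetric]
    using D by (auto simp: pos_divide_le_eq mult_left_mono mult_right_mono max_def mult.commute)
  have "1 - p - q \<le> maxpow_value n u v h" if "p + q < 1"
  proof -
    define s where "s = p + q"
    have s: "0 \<le> s" "s < 1" "s < n" using that n pq by (auto simp: s_def)
    have "u + v - 1 = 1 - s / n" using n by (simp add: s_def p_def q_def field_simps)
    then have hs: "1 - s / n \<le> h" "0 < 1 - s / n" using h(4) s by auto
    have "u * v = 1 - s / n + p * q / n^2"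
      using n by (simp add: s_def p_def q_def field_simps power2_eq_square)
    then have "u * v / h \<le> (1 - s / n + p * q / n^2) / (1 - s / n)"
      using hs pq by (simp add: frac_le)
    also have "\<dots> = 1 + p * q / (n * (n - s))"
      using s n by (simp add: field_simps power2_eq_square)
    finally have "n * (u * v / h) \<le> n * (1 + p * q / (n * (n - s)))" by (intro mult_left_mono) auto
    also have "\<dots> = n + p * q / (n - s)" using n by (simp add: distrib_left)
    finally have "n * (u * v / h) \<le> n + p * q / (n - s)" .
    then have "D \<le> 1 + p * q / (n - s)" by (simp add: D_def algebra_simps)
    also have "\<dots> \<le> 1 + p * q / (1 - s)"
      using s n pq by (intro add_left_mono divide_left_mono) auto
    finally have "(1 - s) * D \<le> (1 - s) * (1 + p * q / (1 - s))" using s by (intro mult_left_mono) auto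
    also have "\<dots> = (1 - p) * (1 - q)" using s by (simp add: s_def field_simps)
    finally have "(1 - s) * D \<le> (1 - p) * (1 - q)" .
    moreover have "0 < h" using hs by linarith
    moreover from this have "0 < D" using D(1) s pq by (auto simp: s_def)
    ultimately have "0 < h" "1 - s \<le> (1 - p) * (1 - q) / D" by (auto simp: pos_le_divide_eq)
    then show ?thesis using s pq unfolding val by (auto simp: s_def)
  qed
  then show "max 0 (1 - n * (1 - u)) + max 0 (1 - n * (1 - v)) - 1 \<le> maxpow_value n u v h"
    unfolding p_def[symmetric] q_def[symmetric] using nn pq by (cases "p + q < 1") auto
qed

text \<open>
Each convolution adds one to the factor in front of \<open>u v / h - 1\<close>. The induction needs the marginals
of the powers already formed; the Frechet bounds sandwich the closed form between functions with the
right limits.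
\<close>

lemma bifree_maxpow_eq_maxpow_value:
  assumes H: "is_bivariate_df H" and n: "1 \<le> n"
  shows "bifree_maxpow H n x1 x2 = maxpow_value n (marginal1 H x1) (marginal2 H x2) (H x1 x2)"
proof -
  note facts = bivariate_df_facts[OF H]
  define val where "val n x1 x2 = maxpow_value n (marginal1 H x1) (marginal2 H x2) (H x1 x2)"
    for n x1 x2
  have bounds: "val n x1 x2 \<le> max 0 (1 - n * (1 - marginal1 H x1))"
    "val n x1 x2 \<le> max 0 (1 - n * (1 - marginal2 H x2))"
    "max 0 (1 - n * (1 - marginal1 H x1)) + max 0 (1 - n * (1 - marginal2 H x2)) - 1 \<le> val n x1 x2"
    if "1 \<le> n" for n x1 x2
    unfolding val_def
    using maxpow_value_bounds(2-)[OF facts(1-3) bivariate_df_frechet_lower[OF H] facts(4,5) that] .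
  have tail: "((\<lambda>x. max 0 (1 - real n * (1 - m x))) \<longlongrightarrow> 1) at_top" if "(m \<longlongrightarrow> 1) at_top"
    for m :: "real \<Rightarrow> real" and n
    using that by (auto intro!: tendsto_eq_intros)
  have marg: "marginal1 (val n) x1 = max 0 (1 - n * (1 - marginal1 H x1))"
    "marginal2 (val n) x2 = max 0 (1 - n * (1 - marginal2 H x2))" if n: "1 \<le> n" for n x1 x2
  proof -
    have "((\<lambda>x2. val n x1 x2) \<longlongrightarrow> max 0 (1 - n * (1 - marginal1 H x1))) at_top"
    proof (rule tendsto_sandwich[OF _ _ _ tendsto_const])
      show "((\<lambda>x2. max 0 (1 - n * (1 - marginal1 H x1)) + max 0 (1 - n * (1 - marginal2 H x2)) - 1)
          \<longlongrightarrow> max 0 (1 - n * (1 - marginal1 H x1))) at_top"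
        by (rule tendsto_eq_intros tail[OF facts(9)] refl)+ simp
    qed (use bounds[OF n] in auto)
    then show "marginal1 (val n) x1 = max 0 (1 - n * (1 - marginal1 H x1))"
      unfolding marginal1_def[of "val n"] by (intro tendsto_Lim) auto
    have "((\<lambda>x1. val n x1 x2) \<longlongrightarrow> max 0 (1 - n * (1 - marginal2 H x2))) at_top"
    proof (rule tendsto_sandwich[OF _ _ _ tendsto_const])
      show "((\<lambda>x1. max 0 (1 - n * (1 - marginal1 H x1)) + max 0 (1 - n * (1 - marginal2 H x2)) - 1)
          \<longlongrightarrow> max 0 (1 - n * (1 - marginal2 H x2))) at_top"
        by (rule tendsto_eq_intros tail[OF facts(8)] refl)+ simp
    qed (use bounds[OF n] in auto)
    then show "marginal2 (val n) x2 = max 0 (1 - n * (1 - marginal2 H x2))"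
      unfolding marginal2_def[of "val n"] by (intro tendsto_Lim) auto
  qed
  have "bifree_maxpow H (Suc k) = val (Suc k)" for k
  proof (induction k)
    case 0
    have "val (Suc 0) x1 x2 = H x1 x2" for x1 x2
    proof (cases "H x1 x2 = 0")
      case False
      then show ?thesis
        using facts(1-3)[of x1 x2] by (auto simp: val_def maxpow_value_def)
    qed (simp add: val_def maxpow_value_def)
    then show ?case by (simp add: bifree_maxpow_def fun_eq_iff)
  next
    case (Suc k)
    have "(val (Suc k) \<star> H) x1 x2 = val (Suc (Suc k)) x1 x2" for x1 x2
    proof -
      define u v h N where "u = marginal1 H x1" and "v = marginal2 H x2" and "h = H x1 x2"
        and "N = Suc k"
      have uv: "0 \<le> h" "h \<le> u" "h \<le> v" "u \<le> 1" "v \<le> 1"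
        using facts(1-5) by (auto simp: u_def v_def h_def)
      have N1: "1 \<le> N" by (simp add: N_def)
      have valN: "val N x1 x2 = maxpow_value N u v h" by (simp add: val_def u_def v_def h_def)
      \<comment> \<open>Truncating at \<open>0\<close> after every convolution has the same effect as truncating once at the end.\<close>
      have step: "max 0 (max 0 (1 - real N * (1 - t)) + t - 1) = max 0 (1 - Suc N * (1 - t))"
        if "t \<le> 1" for t :: real
        using that by (auto simp: max_def algebra_simps)
      have imp: "0 < 1 - real N * (1 - t)" if "0 < 1 - Suc N * (1 - t)" "t \<le> 1" for t :: real
        using that by (auto simp: algebra_simps)
      have "(val (Suc k) \<star> H) x1 x2 =
        (if 0 < maxpow_value N u v h \<and> 0 < h \<and> 0 < 1 - Suc N * (1 - u) \<and> 0 < 1 - Suc N * (1 - v)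
         then (1 - Suc N * (1 - u)) * (1 - Suc N * (1 - v)) /
           (max 0 (1 - real N * (1 - u)) * max 0 (1 - real N * (1 - v)) / maxpow_value N u v h
            + u * v / h - 1) else 0)"
        unfolding bifree_maxconv_def Let_def N_def[symmetric] marg[OF N1] valN
          u_def[symmetric] v_def[symmetric] h_def[symmetric] step[OF uv(4)] step[OF uv(5)]
        by (intro if_cong) (auto simp: less_max_iff_disj max_absorb2 less_imp_le simp del: of_nat_Suc)
      also have "\<dots> = maxpow_value (Suc N) u v h"
      proof (cases "0 < h \<and> 0 < 1 - Suc N * (1 - u) \<and> 0 < 1 - Suc N * (1 - v)")
        case True
        have K: "0 < 1 - real N * (1 - u)" "0 < 1 - real N * (1 - v)" using imp True uv by blast+
        then have "0 < maxpow_value N u v h" using maxpow_value_pos_iff[OF uv(1-3), of N] True by blast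
        moreover have "(1 - real N * (1 - u)) * (1 - real N * (1 - v)) / maxpow_value N u v h =
            1 + N * (u * v / h - 1)"
          using K True calculation by (auto simp: maxpow_value_def)
        moreover have "1 + N * (u * v / h - 1) + u * v / h - 1 = 1 + Suc N * (u * v / h - 1)"
          by (simp add: distrib_right)
        ultimately show ?thesis using True K
          by (simp add: maxpow_value_def[of "Suc N"] del: of_nat_Suc)
      qed (auto simp: maxpow_value_def[of "Suc N"] simp del: of_nat_Suc)
      finally show ?thesis by (simp add: val_def u_def v_def h_def N_def)
    qed
    then have "val (Suc k) \<star> H = val (Suc (Suc k))" by blast
    moreover have "bifree_maxpow H (Suc (Suc k)) = bifree_maxpow H (Suc k) \<star> H"
      by (simp add: bifree_maxpow_def)
    ultimately show ?case using Suc by simp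
  qed
  from this[of "n - 1"] n show ?thesis by (simp add: val_def)
qed
section \<open>Scaled tails and convergence at a point\<close>

text \<open>
Comparing \<open>h ^ n\<close> with the exponential uniformly in \<open>h\<close> avoids a separate treatment of the points
where \<open>n (1 - h)\<close> tends to infinity. With \<open>s = 1 - h\<close>, the bases \<open>h\<close> and \<open>exp (- s)\<close> differ by at
most \<open>s\<^sup>2\<close>, hence the powers by at most \<open>n s\<^sup>2 exp (- (n - 1) s)\<close>; now \<open>t\<^sup>2 exp (- t) \<le> 2\<close> for
\<open>t = n s\<close>, and \<open>exp s \<le> 3\<close>.
\<close>

lemma exp_power_diff:
  fixes h :: real
  assumes h: "0 \<le> h" "h \<le> 1" and n: "1 \<le> n"
  shows "\<bar>h ^ n - exp (- (n * (1 - h)))\<bar> \<le> 6 / n"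
proof -
  define s where "s = 1 - h"
  have s: "0 \<le> s" "s \<le> 1" "h = 1 - s" using h by (auto simp: s_def)
  have ge: "h \<le> exp (- s)" using exp_ge_add_one_self[of "- s"] s by simp
  have "exp (- s) \<le> 1 / (1 + s)"
    using exp_ge_add_one_self[of s] s by (simp add: exp_minus field_simps)
  also have "\<dots> \<le> 1 - s + s\<^sup>2"
  proof -
    have "(1 - s + s\<^sup>2) * (1 + s) = 1 + s ^ 3"
      by (simp add: algebra_simps power2_eq_square power3_eq_cube)
    then have "1 \<le> (1 - s + s\<^sup>2) * (1 + s)" using s by simp
    then show ?thesis using s by (simp add: pos_divide_le_eq)
  qed
  finally have le: "exp (- s) - h \<le> s\<^sup>2" by (simp add: s)
  have pow: "a ^ Suc k - b ^ Suc k \<le> Suc k * ((a - b) * a ^ k)" if "0 \<le> b" "b \<le> a" for a b :: real and k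
  proof (induction k)
    case (Suc k)
    have "a ^ Suc (Suc k) - b ^ Suc (Suc k) = a * (a ^ Suc k - b ^ Suc k) + b ^ Suc k * (a - b)"
      by (simp add: algebra_simps)
    also have "\<dots> \<le> a * (Suc k * ((a - b) * a ^ k)) + a ^ Suc k * (a - b)"
      using that Suc by (intro add_mono mult_left_mono mult_right_mono power_mono) auto
    also have "\<dots> = Suc (Suc k) * ((a - b) * a ^ Suc k)" by (simp add: algebra_simps)
    finally show ?case .
  qed simp
  obtain k where k: "n = Suc k" using n by (cases n) auto
  have "exp (- s) ^ n - h ^ n \<le> n * ((exp (- s) - h) * exp (- s) ^ k)"
    unfolding k by (rule pow[OF h(1) ge])
  also have "\<dots> \<le> n * (s\<^sup>2 * exp (- s) ^ k)"
    using le by (intro mult_left_mono mult_right_mono) auto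
  also have "exp (- s) ^ k = exp (- (n * s)) * exp s"
    by (simp add: k algebra_simps flip: exp_of_nat_mult exp_add)
  also have "n * (s\<^sup>2 * (exp (- (n * s)) * exp s)) = (n * s)\<^sup>2 * exp (- (n * s)) * exp s / n"
    using n by (simp add: power2_eq_square)
  also have "\<dots> \<le> 2 * 3 / n"
  proof (intro divide_right_mono mult_mono)
    have "(n * s)\<^sup>2 / 2 \<le> exp (n * s)"
      using exp_lower_Taylor_quadratic[of "n * s"] s by (smt (verit) mult_nonneg_nonneg of_nat_0_le_iff)
    then show "(n * s)\<^sup>2 * exp (- (n * s)) \<le> 2" by (simp add: exp_minus field_simps)
    show "exp s \<le> 3" using exp_le s by (meson exp_le_cancel_iff order_trans)
  qed auto
  finally have "exp (- s) ^ n - h ^ n \<le> 6 / n" by simp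
  moreover have "h ^ n \<le> exp (- s) ^ n" using ge h by (intro power_mono)
  moreover have "exp (- s) ^ n = exp (- (n * (1 - h)))"
    by (simp add: s_def algebra_simps flip: exp_of_nat_mult)
  ultimately show ?thesis by linarith
qed

lemma tendsto_power_iff_tendsto_exp:
  fixes h :: "nat \<Rightarrow> real"
  assumes "\<And>n. 0 \<le> h n" "\<And>n. h n \<le> 1"
  shows "(\<lambda>n. h n ^ n) \<longlonglongrightarrow> c \<longleftrightarrow> (\<lambda>n. exp (- (n * (1 - h n)))) \<longlonglongrightarrow> c"
proof (rule Lim_transform_eq)
  have "(\<lambda>n. 6 / real n) \<longlonglongrightarrow> 0" by real_asymp
  then show "(\<lambda>n. h n ^ n - exp (- (n * (1 - h n)))) \<longlonglongrightarrow> 0"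
  proof (rule Lim_null_comparison[rotated])
    show "\<forall>\<^sub>F n in sequentially. norm (h n ^ n - exp (- (n * (1 - h n)))) \<le> 6 / n"
      using eventually_ge_at_top[of 1]
      by eventually_elim (simp only: real_norm_def exp_power_diff assms)
  qed
qed

text \<open>
Pointwise convergence of bivariate functions does not give convergence of the marginals unless no
mass escapes. Here the lower Frechet bound yields \<open>u n x1 \<le> h n x1 z + 1 - h n y z\<close>, and the limit of
\<open>h n y z\<close> is close to \<open>1\<close> for large \<open>y\<close> and \<open>z\<close>, because it dominates \<open>k1 y * k2 z\<close>. The lemma
serves both kinds of powers.
\<close>

lemma marginal_tendsto:
  fixes h :: "nat \<Rightarrow> real \<Rightarrow> real \<Rightarrow> real"
  assumes frechet: "\<And>n x1 x2. 1 \<le> n \<Longrightarrow> h n x1 x2 \<le> u n x1" "\<And>n x1 x2. 1 \<le> n \<Longrightarrow> h n x1 x2 \<le> v n x2"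
      "\<And>n x1 x2. 1 \<le> n \<Longrightarrow> u n x1 + v n x2 - 1 \<le> h n x1 x2"
    and lim: "\<And>x1 x2. (\<lambda>n. h n x1 x2) \<longlonglongrightarrow> K x1 x2"
    and K: "\<And>x1 x2. k1 x1 * k2 x2 \<le> K x1 x2" "\<And>x1 x2. K x1 x2 \<le> k1 x1"
    and k: "\<And>x. 0 \<le> k1 x" "\<And>x. k1 x \<le> 1" "(k1 \<longlongrightarrow> 1) at_top" "(k2 \<longlongrightarrow> 1) at_top"
  shows "(\<lambda>n. u n x1) \<longlonglongrightarrow> k1 x1"
proof (rule LIMSEQ_I)
  fix r :: real assume r: "0 < r"
  define \<epsilon> where "\<epsilon> = min (r / 5) (1 / 2)"
  have \<epsilon>: "0 < \<epsilon>" "\<epsilon> \<le> 1 / 2" "5 * \<epsilon> \<le> r" using r by (auto simp: \<epsilon>_def)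
  \<comment> \<open>The point \<open>(y, z)\<close> is so far out that little mass lies beyond it in the limit.\<close>
  have "\<exists>y. 1 - \<epsilon> < k1 y" "\<exists>z. 1 - \<epsilon> < k2 z"
    using eventually_happens'[OF _ order_tendstoD(1)[OF k(3), of "1 - \<epsilon>"]]
      eventually_happens'[OF _ order_tendstoD(1)[OF k(4), of "1 - \<epsilon>"]] \<epsilon> by auto
  then obtain y z where yz: "1 - \<epsilon> < k1 y" "1 - \<epsilon> < k2 z" by blast
  have "(1 - \<epsilon>) * (1 - \<epsilon>) \<le> k1 y * k2 z" using yz \<epsilon> by (intro mult_mono) auto
  also have "\<dots> \<le> K y z" by (rule K)
  also have "(1 - \<epsilon>) * (1 - \<epsilon>) = 1 - 2 * \<epsilon> + \<epsilon> * \<epsilon>" by (simp add: algebra_simps)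
  finally have Ky: "1 - 2 * \<epsilon> \<le> K y z" using zero_le_square[of \<epsilon>] by linarith
  have "k1 x1 * (1 - \<epsilon>) \<le> k1 x1 * k2 z" using yz k(1)[of x1] by (intro mult_left_mono) auto
  also have "\<dots> \<le> K x1 z" by (rule K)
  also have "k1 x1 * (1 - \<epsilon>) = k1 x1 - k1 x1 * \<epsilon>" by (simp add: algebra_simps)
  finally have Kx: "k1 x1 - \<epsilon> \<le> K x1 z"
    using mult_right_mono[OF k(2)[of x1] less_imp_le[OF \<epsilon>(1)]] by linarith
  have "\<forall>\<^sub>F n in sequentially. \<bar>h n x1 z - K x1 z\<bar> < \<epsilon>"
    "\<forall>\<^sub>F n in sequentially. \<bar>h n y z - K y z\<bar> < \<epsilon>"
    using tendstoD[OF lim \<epsilon>(1)] by (auto simp: dist_real_def)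
  then have "\<forall>\<^sub>F n in sequentially. \<bar>u n x1 - k1 x1\<bar> < r"
    using eventually_ge_at_top[of 1]
  proof eventually_elim
    case (elim n)
    show ?case
      using elim(1,2) frechet(1)[OF elim(3), of x1 z] frechet(2)[OF elim(3), of y z]
        frechet(3)[OF elim(3), of x1 z] Ky Kx K(2)[of x1 z] \<epsilon> by linarith
  qed
  then show "\<exists>no. \<forall>n\<ge>no. norm (u n x1 - k1 x1) < r"
    by (simp add: eventually_sequentially)
qed

lemma tendsto_1_if_scaled:
  fixes h :: "nat \<Rightarrow> real"
  assumes "(\<lambda>n. n * (1 - h n)) \<longlonglongrightarrow> r"
  shows "h \<longlonglongrightarrow> 1"
proof -
  have "(\<lambda>n. 1 - (n * (1 - h n)) * (1 / real n)) \<longlonglongrightarrow> 1 - r * 0"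
    by (intro tendsto_intros assms lim_1_over_n)
  moreover have "\<forall>\<^sub>F n in sequentially. 1 - (n * (1 - h n)) * (1 / real n) = h n"
    using eventually_gt_at_top[of 0] by eventually_elim simp
  ultimately show ?thesis using Lim_transform_eventually by fastforce
qed

text \<open>
By expansion, \<open>n (u v / h - 1)\<close> is the quotient by \<open>h\<close> of
\<open>n (1 - h) - n (1 - u) - n (1 - v) + (n (1 - u)) (n (1 - v)) / n\<close>, and \<open>h\<close> tends to \<open>1\<close>.
\<close>

lemma maxpow_value_tendsto:
  fixes u v h :: "nat \<Rightarrow> real"
  assumes p: "(\<lambda>n. n * (1 - u n)) \<longlonglongrightarrow> p" "p < 1"
    and q: "(\<lambda>n. n * (1 - v n)) \<longlonglongrightarrow> q" "q < 1"
    and r: "(\<lambda>n. n * (1 - h n)) \<longlonglongrightarrow> r" and D: "0 < 1 - p - q + r"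
  shows "(\<lambda>n. maxpow_value n (u n) (v n) (h n)) \<longlonglongrightarrow> (1 - p) * (1 - q) / (1 - p - q + r)"
proof -
  let ?E = "\<lambda>n. 1 + (n * (1 - h n) - n * (1 - u n) - n * (1 - v n) +
    n * (1 - u n) * (n * (1 - v n)) * (1 / real n)) / h n"
  have h1: "h \<longlonglongrightarrow> 1" by (rule tendsto_1_if_scaled[OF r])
  have "?E \<longlonglongrightarrow> 1 + (r - p - q + p * q * 0) / 1"
    by (intro tendsto_intros p q r h1 lim_1_over_n) simp
  then have E: "?E \<longlonglongrightarrow> 1 - p - q + r" by (simp add: algebra_simps)
  have "(\<lambda>n. (1 - n * (1 - u n)) * (1 - n * (1 - v n)) / ?E n) \<longlonglongrightarrow>
      (1 - p) * (1 - q) / (1 - p - q + r)"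
    using D by (intro tendsto_intros p q E) auto
  moreover have "\<forall>\<^sub>F n in sequentially. (1 - n * (1 - u n)) * (1 - n * (1 - v n)) / ?E n =
      maxpow_value n (u n) (v n) (h n)"
    using order_tendstoD(2)[OF p] order_tendstoD(2)[OF q] order_tendstoD(1)[OF h1 zero_less_one]
      eventually_gt_at_top[of 0]
  proof eventually_elim
    case (elim n)
    then have "?E n = 1 + n * (u n * v n / h n - 1)" by (simp add: field_simps)
    with elim show ?case by (simp add: maxpow_value_def)
  qed
  ultimately show ?thesis by (rule Lim_transform_eventually)
qed

text \<open>
A positive limit makes the closed form apply eventually. Solving it for \<open>n (u v / h - 1)\<close> shows that
this quantity converges, so that \<open>h\<close> tends to \<open>1\<close>, and then the same expansion gives \<open>n (1 - h)\<close>.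
\<close>

lemma scaled_tendsto_if_maxpow_value_tendsto:
  fixes u v h :: "nat \<Rightarrow> real"
  assumes p: "(\<lambda>n. n * (1 - u n)) \<longlonglongrightarrow> p" "p < 1"
    and q: "(\<lambda>n. n * (1 - v n)) \<longlonglongrightarrow> q" "q < 1"
    and D: "0 < 1 - p - q + r"
    and K: "(\<lambda>n. maxpow_value n (u n) (v n) (h n)) \<longlonglongrightarrow> (1 - p) * (1 - q) / (1 - p - q + r)"
  shows "(\<lambda>n. n * (1 - h n)) \<longlonglongrightarrow> r"
proof -
  let ?val = "\<lambda>n. maxpow_value n (u n) (v n) (h n)"
  \<comment> \<open>This is \<open>n (u v / h - 1)\<close>, recovered from the value of the power.\<close>
  let ?L = "\<lambda>n. (1 - n * (1 - u n)) * (1 - n * (1 - v n)) / ?val n - 1"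
  have Kpos: "0 < (1 - p) * (1 - q) / (1 - p - q + r)" using p q D by simp
  have "?L \<longlonglongrightarrow> (1 - p) * (1 - q) / ((1 - p) * (1 - q) / (1 - p - q + r)) - 1"
    using Kpos by (intro tendsto_intros p q K) auto
  moreover have "(1 - p) * (1 - q) / ((1 - p) * (1 - q) / (1 - p - q + r)) - 1 = r - p - q"
    using p q D by simp
  ultimately have L: "?L \<longlonglongrightarrow> r - p - q" by simp
  have ev: "\<forall>\<^sub>F n in sequentially. 0 < n \<and> 0 < h n \<and> ?L n = n * (u n * v n / h n - 1)"
    using order_tendstoD(1)[OF K Kpos] eventually_gt_at_top[of 0]
  proof eventually_elim
    case (elim n)
    then have "0 < h n \<and> 0 < 1 - n * (1 - u n) \<and> 0 < 1 - n * (1 - v n)"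
      by (metis less_irrefl maxpow_value_def)
    with elim show ?case by (simp add: maxpow_value_def)
  qed
  have "(\<lambda>n. u n * v n / (1 + ?L n * (1 / real n))) \<longlonglongrightarrow> 1 * 1 / (1 + (r - p - q) * 0)"
    by (intro tendsto_intros tendsto_1_if_scaled[OF p(1)] tendsto_1_if_scaled[OF q(1)] L lim_1_over_n) simp
  moreover have "\<forall>\<^sub>F n in sequentially. u n * v n / (1 + ?L n * (1 / real n)) = h n"
    using ev order_tendstoD(1)[OF tendsto_1_if_scaled[OF p(1)] zero_less_one]
      order_tendstoD(1)[OF tendsto_1_if_scaled[OF q(1)] zero_less_one]
  proof eventually_elim
    case (elim n)
    then have "?L n * (1 / real n) = u n * v n / h n - 1" by simp
    with elim show ?case by (simp only:) simp
  qed
  ultimately have h1: "h \<longlonglongrightarrow> 1" using Lim_transform_eventually by fastforce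
  have "(\<lambda>n. h n * ?L n + n * (1 - u n) + n * (1 - v n) -
      n * (1 - u n) * (n * (1 - v n)) * (1 / real n)) \<longlonglongrightarrow> 1 * (r - p - q) + p + q - p * q * 0"
    by (intro tendsto_intros p q h1 L lim_1_over_n)
  moreover have "\<forall>\<^sub>F n in sequentially. h n * ?L n + n * (1 - u n) + n * (1 - v n) -
      n * (1 - u n) * (n * (1 - v n)) * (1 / real n) = n * (1 - h n)"
    using ev
  proof eventually_elim
    case (elim n)
    have "h n * ?L n = h n * (n * (u n * v n / h n - 1))"
      by (simp only: conjunct2[OF conjunct2[OF elim]])
    also have "\<dots> = n * (u n * v n - h n)" using elim by (simp add: field_simps)
    finally have "h n * ?L n = n * (u n * v n - h n)" .
    with elim show ?case by (simp only:) (simp add: field_simps)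
  qed
  ultimately show ?thesis using Lim_transform_eventually by fastforce
qed

lemma pos_one_plus_ln_exp: "pos_one_plus_ln (exp t) = max 0 (1 + t)"
  by (simp add: pos_one_plus_ln_def)

lemma pos_one_plus_ln_pos_iff: "0 < pos_one_plus_ln c \<longleftrightarrow> exp (- 1) < c"
proof (cases "0 < c")
  case True
  then have "exp (- 1) < c \<longleftrightarrow> - 1 < ln c" by (metis exp_ln exp_less_cancel_iff)
  then show ?thesis using True by (auto simp: pos_one_plus_ln_def)
next
  case False
  then have "\<not> exp (- 1) < c" using exp_gt_zero[of "- 1 :: real"] by linarith
  then show ?thesis using False by (simp add: pos_one_plus_ln_def)
qed

lemma pos_one_plus_ln_bounds: "0 \<le> pos_one_plus_ln c" "c \<le> 1 \<Longrightarrow> pos_one_plus_ln c \<le> 1"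
  by (auto simp: pos_one_plus_ln_def)

lemma isCont_pos_one_plus_ln: "isCont pos_one_plus_ln c"
proof (cases "0 < c")
  case True
  have "\<forall>\<^sub>F y in nhds c. pos_one_plus_ln y = max 0 (1 + ln y)"
    using True eventually_nhds_in_open[OF open_greaterThan, of c 0]
    by (auto elim!: eventually_mono simp: pos_one_plus_ln_def)
  moreover have "isCont (\<lambda>y. max 0 (1 + ln y)) c"
    using True by (intro continuous_intros) auto
  ultimately show ?thesis by (subst isCont_cong)
next
  case False
  have "c < exp (- 1)" using False exp_gt_zero[of "- 1 :: real"] by linarith
  then have "\<forall>\<^sub>F y in nhds c. y \<in> {..<exp (- 1)}"
    by (intro eventually_nhds_in_open) auto
  then have "\<forall>\<^sub>F y in nhds c. pos_one_plus_ln y = 0"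
  proof eventually_elim
    case (elim y)
    then have "\<not> 0 < pos_one_plus_ln y" by (simp add: pos_one_plus_ln_pos_iff)
    then show ?case using pos_one_plus_ln_bounds(1)[of y] by linarith
  qed
  then show ?thesis by (subst isCont_cong) auto
qed

section \<open>Change of normalization\<close>

text \<open>
Since \<open>n / (n div k)\<close> tends to \<open>k\<close>, replacing the index of the tail \<open>w\<close> by \<open>n div k\<close>, but not the
factor \<open>n\<close>, multiplies the limiting exponent by \<open>k\<close>.
\<close>

lemma tendsto_exp_index_div:
  fixes w :: "nat \<Rightarrow> real"
  assumes lim: "(\<lambda>n. exp (- (n * w n))) \<longlonglongrightarrow> c" and c: "0 < c" and k: "1 \<le> k"
  shows "(\<lambda>n. exp (- (n * w (n div k)))) \<longlonglongrightarrow> c ^ k"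
proof -
  have div: "filterlim (\<lambda>n. n div k) at_top sequentially"
    using k by (intro filterlim_at_top_div_const_nat) auto
  have "(\<lambda>n. - ln (exp (- (real n * w n)))) \<longlonglongrightarrow> - ln c"
    using c by (intro tendsto_intros lim) auto
  then have "(\<lambda>n. real n * w n) \<longlonglongrightarrow> - ln c" by simp
  then have m: "(\<lambda>n. real (n div k) * w (n div k)) \<longlonglongrightarrow> - ln c"
    by (rule filterlim_compose[OF _ div])
  have z: "(\<lambda>n. 1 / real (n div k)) \<longlonglongrightarrow> 0" by (rule filterlim_compose[OF lim_1_over_n div])
  have "(\<lambda>n. real (n mod k) / real (n div k)) \<longlonglongrightarrow> 0"
  proof (rule Lim_null_comparison)
    show "(\<lambda>n. real k * (1 / real (n div k))) \<longlonglongrightarrow> 0" using tendsto_mult[OF tendsto_const z, of "real k"] by simp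
    show "\<forall>\<^sub>F n in sequentially. norm (real (n mod k) / real (n div k)) \<le> real k * (1 / real (n div k))"
      using k by (intro always_eventually allI) (auto intro!: divide_right_mono simp: less_imp_le)
  qed
  then have "(\<lambda>n. exp (- ((real k + real (n mod k) / real (n div k)) * (real (n div k) * w (n div k)))))
      \<longlonglongrightarrow> exp (- ((real k + 0) * (- ln c)))"
    by (intro tendsto_intros m)
  moreover have "\<forall>\<^sub>F n in sequentially.
      exp (- ((real k + real (n mod k) / real (n div k)) * (real (n div k) * w (n div k)))) =
      exp (- (n * w (n div k)))"
    using filterlim_at_top[THEN iffD1, OF div, rule_format, of 1]
  proof eventually_elim
    case (elim n)
    have "real n = real k * real (n div k) + real (n mod k)"
      by (metis div_mult_mod_eq mult.commute of_nat_add of_nat_mult)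
    with elim show ?case by (simp add: field_simps)
  qed
  moreover have "exp (- ((real k + 0) * (- ln c))) = c ^ k"
    using c by (simp add: exp_of_nat_mult)
  ultimately show ?thesis using Lim_transform_eventually by fastforce
qed

text \<open>
A convergence of types argument. Let \<open>T n\<close> be the affine map that turns the normalization at index
\<open>n\<close> into the one at index \<open>n div k\<close>. The functions \<open>U n\<close> converge to \<open>g\<close> where \<open>g > \<theta>\<close>, and along
\<open>T n y\<close> they converge to \<open>g y ^ k\<close>, the value of \<open>g\<close> at \<open>\<alpha> y + \<beta>\<close>. As \<open>g\<close> is strictly increasing
there, this locates the limit of \<open>T n y\<close>, provided that \<open>g (\<alpha> y + \<beta>)\<close> lies in \<open>(\<theta>, 1)\<close>. Affine maps
that converge at two points converge everywhere.
\<close>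

lemma (in max_stable_df) affine_change_tendsto:
  fixes f :: "real \<Rightarrow> real" and a b :: "nat \<Rightarrow> real"
  assumes f: "mono f" and a: "\<And>n. 0 < a n" and \<theta>: "0 \<le> \<theta>" "\<theta> < 1"
    and lim: "\<And>x. \<theta> < g x \<Longrightarrow> (\<lambda>n. exp (- (n * (1 - f (a n * x + b n))))) \<longlonglongrightarrow> g x"
    and k: "1 \<le> k" and \<alpha>: "0 < \<alpha>" and stable: "\<And>y. g (\<alpha> * y + \<beta>) = g y ^ k"
  shows "(\<lambda>n. (a (n div k) * y + b (n div k) - b n) / a n) \<longlonglongrightarrow> \<alpha> * y + \<beta>"
proof -
  define T where "T n y = (a (n div k) * y + b (n div k) - b n) / a n" for n y
  define U where "U n x = exp (- (n * (1 - f (a n * x + b n))))" for n x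
  have U_less: "x < y" if "U n x < U n y" for n x y
  proof (rule ccontr)
    assume "\<not> x < y"
    then have "f (a n * y + b n) \<le> f (a n * x + b n)" using a[of n] by (intro monoD[OF f]) auto
    then have "U n y \<le> U n x" by (simp add: U_def mult_left_mono)
    with that show False by simp
  qed
  have U_lim: "(\<lambda>n. U n x) \<longlonglongrightarrow> g x" if "\<theta> < g x" for x
    unfolding U_def by (rule lim[OF that])
  have UT: "U n (T n y) = exp (- (n * (1 - f (a (n div k) * y + b (n div k)))))" for n y
    using a[of n] by (simp add: U_def T_def)
  have core: "(\<lambda>n. T n y) \<longlonglongrightarrow> \<alpha> * y + \<beta>" if z: "\<theta> < g (\<alpha> * y + \<beta>)" "g (\<alpha> * y + \<beta>) < 1" for y
  proof -
    define z where "z = \<alpha> * y + \<beta>"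
    have gz: "g z = g y ^ k" using stable by (simp add: z_def)
    have "g y ^ k \<le> g y ^ 1" using g_nonneg g_le_1 k by (intro power_decreasing)
    then have gy: "\<theta> < g y" using z gz by (simp add: z_def)
    have lz: "(\<lambda>n. U n (T n y)) \<longlonglongrightarrow> g z"
      unfolding UT gz using lim[OF gy] gy \<theta> k by (intro tendsto_exp_index_div) auto
    show ?thesis
      unfolding z_def[symmetric]
    proof (rule order_tendstoI)
      fix c assume "c < z"
      have "\<forall>\<^sub>F x in at_left z. \<theta> < g x"
        using isCont_g[of z] z(1) unfolding isCont_def z_def[symmetric]
        by (intro order_tendstoD(1)[OF tendsto_within_subset]) auto
      moreover have "\<forall>\<^sub>F x in at_left z. c < x \<and> x < z"
        using \<open>c < z\<close> eventually_at_left_real[of c z] by (auto elim!: eventually_mono)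
      ultimately obtain x where x: "\<theta> < g x" "c < x" "x < z"
        using eventually_happens'[OF _ eventually_conj, of "at_left z"] by (metis (mono_tags, lifting) trivial_limit_at_left_real)
      have "g x < g z"
        using x \<theta> g_strict[of x z] g_mono[of x z] z(2) by (auto simp: z_def)
      then have "\<forall>\<^sub>F n in sequentially. U n x < (g x + g z) / 2"
        "\<forall>\<^sub>F n in sequentially. (g x + g z) / 2 < U n (T n y)"
        by (intro order_tendstoD(2)[OF U_lim[OF x(1)]] order_tendstoD(1)[OF lz]; simp)+
      then show "\<forall>\<^sub>F n in sequentially. c < T n y"
        by eventually_elim (use x(2) U_less in \<open>meson less_trans\<close>)
    next
      fix c assume "z < c"
      then have "g z < g c" using g_strict[of z c] z \<theta> by (auto simp: z_def)
      moreover from this have "\<theta> < g c" using z by (simp add: z_def)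
      ultimately have "\<forall>\<^sub>F n in sequentially. (g z + g c) / 2 < U n c"
        "\<forall>\<^sub>F n in sequentially. U n (T n y) < (g z + g c) / 2"
        by (intro order_tendstoD(1)[OF U_lim[of c]] order_tendstoD(2)[OF lz]; simp)+
      then show "\<forall>\<^sub>F n in sequentially. T n y < c"
        by eventually_elim (use U_less in \<open>meson less_trans\<close>)
    qed
  qed
  \<comment> \<open>Any two distinct values in the interval \<open>(\<theta>, 1)\<close> will do.\<close>
  obtain z1 z2 where z: "g z1 = (\<theta> + 1) / 2" "g z2 = (\<theta> + 3) / 4"
    using g_surj[of "(\<theta> + 1) / 2"] g_surj[of "(\<theta> + 3) / 4"] \<theta> by auto
  define y1 y2 where "y1 = (z1 - \<beta>) / \<alpha>" and "y2 = (z2 - \<beta>) / \<alpha>"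
  have y: "\<alpha> * y1 + \<beta> = z1" "\<alpha> * y2 + \<beta> = z2" using \<alpha> by (auto simp: y1_def y2_def)
  have ne: "y1 \<noteq> y2" using y z \<theta> by auto
  have lims: "(\<lambda>n. T n y1) \<longlonglongrightarrow> z1" "(\<lambda>n. T n y2) \<longlonglongrightarrow> z2"
    using core[of y1] core[of y2] y z \<theta> by auto
  have "(\<lambda>n. T n y1 + (y - y1) / (y2 - y1) * (T n y2 - T n y1)) \<longlonglongrightarrow>
      z1 + (y - y1) / (y2 - y1) * (z2 - z1)"
    by (intro tendsto_intros lims)
  moreover have "T n y1 + (y - y1) / (y2 - y1) * (T n y2 - T n y1) = T n y" for n
  proof -
    have "T n y2 - T n y1 = (y2 - y1) * (a (n div k) / a n)" "T n y - T n y1 = (y - y1) * (a (n div k) / a n)"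
      using a[of n] by (auto simp: T_def field_simps)
    then show ?thesis using ne by simp
  qed
  moreover have "z1 + (y - y1) / (y2 - y1) * (z2 - z1) = \<alpha> * y + \<beta>"
  proof -
    have "z2 - z1 = (y2 - y1) * \<alpha>" "\<alpha> * y + \<beta> - z1 = (y - y1) * \<alpha>" by (simp_all add: y[symmetric] algebra_simps)
    then show ?thesis using ne by simp
  qed
  ultimately show ?thesis by (simp add: T_def)
qed

text \<open>
The logarithm of \<open>bivariate_evd\<close> is homogeneous of degree one in the logarithms of its marginals.
\<close>

lemma bivariate_evd_stable:
  assumes k: "1 \<le> k" and g: "0 \<le> G1 y1" "0 \<le> G2 y2"
    and z: "G1 z1 = G1 y1 ^ k" "G2 z2 = G2 y2 ^ k"
  shows "bivariate_evd A G1 G2 z1 z2 = bivariate_evd A G1 G2 y1 y2 ^ k"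
proof (cases "0 < G1 y1 \<and> 0 < G2 y2")
  case True
  have "- ln (G1 z1) = real k * - ln (G1 y1)" "- ln (G2 z2) = real k * - ln (G2 y2)"
    using True by (simp_all add: z ln_realpow)
  then have "tail_dependence A (- ln (G1 z1)) (- ln (G2 z2)) =
      k * tail_dependence A (- ln (G1 y1)) (- ln (G2 y2))"
    using k by (simp only: tail_dependence_scale)
  moreover have "0 < G1 z1 \<and> 0 < G2 z2" using True z by simp
  ultimately show ?thesis using True by (simp add: bivariate_evd_eq flip: exp_of_nat_mult)
next
  case False
  then have "\<not> (0 < G1 z1 \<and> 0 < G2 z2)" using k g z by (auto simp: not_less power_0_left)
  with False show ?thesis using k by (auto simp: bivariate_evd_eq power_0_left)
qed

text \<open>
Convergence on the region \<open>G1, G2 > \<theta>\<close> is enough. Given a point with \<open>G1, G2 > 0\<close>, choose \<open>k\<close> with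
\<open>\<theta> ^ k\<close> below both values; the point is then the image of a point of the region under the affine
maps belonging to \<open>k\<close>. Convergence is known along arguments that only tend to the given point, so
the conclusion uses monotonicity of \<open>H\<close> and continuity of the limit to squeeze from slightly shifted
points. Where \<open>G1\<close> or \<open>G2\<close> vanishes, the values are dominated by those at larger points at which the
limit is positive but small.
\<close>

lemma bivariate_evd_domain_extends:
  fixes H :: "real \<Rightarrow> real \<Rightarrow> real" and a b c d :: "nat \<Rightarrow> real"
  assumes A: "is_pickands A" and G1: "max_stable_df G1" and G2: "max_stable_df G2"
    and H: "is_bivariate_df H" and ac: "\<And>n. 0 < a n" "\<And>n. 0 < c n"
    and \<theta>: "0 < \<theta>" "\<theta> < 1"
    and lim1: "\<And>x. \<theta> < G1 x \<Longrightarrow> (\<lambda>n. exp (- (n * (1 - marginal1 H (a n * x + b n))))) \<longlonglongrightarrow> G1 x"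
    and lim2: "\<And>x. \<theta> < G2 x \<Longrightarrow> (\<lambda>n. exp (- (n * (1 - marginal2 H (c n * x + d n))))) \<longlonglongrightarrow> G2 x"
    and lim: "\<And>x1 x2. \<theta> < G1 x1 \<Longrightarrow> \<theta> < G2 x2 \<Longrightarrow>
      (\<lambda>n. exp (- (n * (1 - H (a n * x1 + b n) (c n * x2 + d n))))) \<longlonglongrightarrow> bivariate_evd A G1 G2 x1 x2"
  shows "(\<lambda>n. exp (- (n * (1 - H (a n * x1 + b n) (c n * x2 + d n))))) \<longlonglongrightarrow> bivariate_evd A G1 G2 x1 x2"
proof -
  interpret G1: max_stable_df G1 by fact
  interpret G2: max_stable_df G2 by fact
  define N where "N n x1 x2 = exp (- (n * (1 - H (a n * x1 + b n) (c n * x2 + d n))))" for n x1 x2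
  define G where "G = bivariate_evd A G1 G2"
  have N_mono: "N n x1 x2 \<le> N n y1 y2" if "x1 \<le> y1" "x2 \<le> y2" for n x1 x2 y1 y2
  proof -
    have "H (a n * x1 + b n) (c n * x2 + d n) \<le> H (a n * y1 + b n) (c n * y2 + d n)"
      using that ac[of n] by (intro bivariate_df_mono[OF H]) auto
    then show ?thesis by (simp add: N_def mult_left_mono)
  qed
  have G_cont: "isCont (\<lambda>(y1, y2). G y1 y2) (x1, x2)" for x1 x2
    unfolding G_def
    by (intro isCont_bivariate_evd[OF A] G1.isCont_g G2.isCont_g)
       (simp_all add: G1.g_nonneg G1.g_le_1 G2.g_nonneg G2.g_le_1)
  have G_bounds: "G x1 x2 \<le> G1 x1" "G x1 x2 \<le> G2 x2" "0 \<le> G x1 x2" for x1 x2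
    using bivariate_evd_bounds(2,3)[OF A, of G1 x1 G2 x2]
    by (simp_all add: G_def bivariate_evd_eq G1.g_nonneg G1.g_le_1 G2.g_nonneg G2.g_le_1)
  have diagonal: "(\<lambda>t. G (x1 + t) (x2 + t)) \<midarrow>0\<rightarrow> G x1 x2" for x1 x2
  proof -
    have "((\<lambda>t. (x1 + t, x2 + t)) \<longlongrightarrow> (x1 + 0, x2 + 0)) (at 0)" by (intro tendsto_intros)
    from isCont_tendsto_compose[OF _ this, of "\<lambda>(y1, y2). G y1 y2"] G_cont[of x1 x2]
    show ?thesis by simp
  qed
  have pos: "(\<lambda>n. N n x1 x2) \<longlonglongrightarrow> G x1 x2" if x: "0 < G1 x1" "0 < G2 x2" for x1 x2
  proof -
    obtain k1 k2 where "\<theta> ^ k1 < G1 x1" "\<theta> ^ k2 < G2 x2"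
      using real_arch_pow_inv[OF x(1) \<theta>(2)] real_arch_pow_inv[OF x(2) \<theta>(2)] by blast
    \<comment> \<open>The exponent \<open>0\<close> is excluded, because \<open>n div k\<close> is to tend to infinity.\<close>
    define k where "k = max 1 (max k1 k2)"
    have k: "1 \<le> k" by (simp add: k_def)
    have "\<theta> ^ k \<le> \<theta> ^ k1" "\<theta> ^ k \<le> \<theta> ^ k2"
      using \<theta> by (auto simp: k_def intro!: power_decreasing)
    then have xk: "\<theta> ^ k < G1 x1" "\<theta> ^ k < G2 x2"
      using \<open>\<theta> ^ k1 < G1 x1\<close> \<open>\<theta> ^ k2 < G2 x2\<close> by linarith+
    obtain \<alpha> \<beta> where \<alpha>: "0 < \<alpha>" and st1: "\<And>y. G1 (\<alpha> * y + \<beta>) = G1 y ^ k"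
      using G1.g_stable[OF k] by blast
    obtain \<gamma> \<delta> where \<gamma>: "0 < \<gamma>" and st2: "\<And>y. G2 (\<gamma> * y + \<delta>) = G2 y ^ k"
      using G2.g_stable[OF k] by blast
    define T where "T n y = (a (n div k) * y + b (n div k) - b n) / a n" for n y
    define S where "S n y = (c (n div k) * y + d (n div k) - d n) / c n" for n y
    have mono1: "mono (marginal1 H)" and mono2: "mono (marginal2 H)"
      using marginal_mono[OF H] by (auto intro: monoI)
    have T: "(\<lambda>n. T n y) \<longlonglongrightarrow> \<alpha> * y + \<beta>" for y
      unfolding T_def using \<theta> by (intro G1.affine_change_tendsto[OF mono1 ac(1) _ _ lim1 k \<alpha> st1]) auto
    have S: "(\<lambda>n. S n y) \<longlonglongrightarrow> \<gamma> * y + \<delta>" for y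
      unfolding S_def using \<theta> by (intro G2.affine_change_tendsto[OF mono2 ac(2) _ _ lim2 k \<gamma> st2]) auto
    define y1 where "y1 z = (z - \<beta>) / \<alpha>" for z
    define y2 where "y2 z = (z - \<delta>) / \<gamma>" for z
    have y: "\<alpha> * y1 z + \<beta> = z" "\<gamma> * y2 z + \<delta> = z" for z
      using \<alpha> \<gamma> by (auto simp: y1_def y2_def)
    have along: "(\<lambda>n. N n (T n (y1 z1)) (S n (y2 z2))) \<longlonglongrightarrow> G z1 z2"
      if z: "\<theta> ^ k < G1 z1" "\<theta> ^ k < G2 z2" for z1 z2
    proof -
      have gy: "G1 z1 = G1 (y1 z1) ^ k" "G2 z2 = G2 (y2 z2) ^ k"
        using st1[of "y1 z1"] st2[of "y2 z2"] by (simp_all add: y)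
      then have "\<theta> < G1 (y1 z1)" "\<theta> < G2 (y2 z2)"
        using z power_less_imp_less_base G1.g_nonneg G2.g_nonneg by metis+
      note l = lim[OF this] and this
      have "0 < bivariate_evd A G1 G2 (y1 z1) (y2 z2)"
        using \<open>\<theta> < G1 (y1 z1)\<close> \<open>\<theta> < G2 (y2 z2)\<close> \<theta> by (simp add: bivariate_evd_eq)
      from tendsto_exp_index_div[OF l this k]
      have "(\<lambda>n. exp (- (n * (1 - H (a (n div k) * y1 z1 + b (n div k)) (c (n div k) * y2 z2 + d (n div k))))))
          \<longlonglongrightarrow> bivariate_evd A G1 G2 (y1 z1) (y2 z2) ^ k" .
      moreover have "bivariate_evd A G1 G2 (y1 z1) (y2 z2) ^ k = G z1 z2"
        unfolding G_def using gy
        by (intro bivariate_evd_stable[OF k, symmetric]) (simp_all add: G1.g_nonneg G2.g_nonneg)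
      moreover have "a n * T n (y1 z1) + b n = a (n div k) * y1 z1 + b (n div k)"
        "c n * S n (y2 z2) + d n = c (n div k) * y2 z2 + d (n div k)" for n
        using ac[of n] by (simp_all add: T_def S_def)
      ultimately show ?thesis by (simp add: N_def)
    qed
    show ?thesis
    proof (rule order_tendstoI)
      \<comment> \<open>A negative shift \<open>t\<close> leaves room for \<open>T n\<close> and \<open>S n\<close> to approach their limits.\<close>
      fix r assume r: "r < G x1 x2"
      have "((\<lambda>t. G1 (x1 + t)) \<longlongrightarrow> G1 x1) (at 0)" "((\<lambda>t. G2 (x2 + t)) \<longlongrightarrow> G2 x2) (at 0)"
        using G1.isCont_g[of x1] G2.isCont_g[of x2] by (simp_all add: isCont_iff)
      from this[THEN order_tendstoD(1)] xk
      have "\<forall>\<^sub>F t in at 0. \<theta> ^ k < G1 (x1 + t)" "\<forall>\<^sub>F t in at 0. \<theta> ^ k < G2 (x2 + t)" by auto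
      moreover have "\<forall>\<^sub>F t in at 0. r < G (x1 + t) (x2 + t)"
        by (rule order_tendstoD(1)[OF diagonal r])
      ultimately have "\<forall>\<^sub>F t in at 0. \<theta> ^ k < G1 (x1 + t) \<and> \<theta> ^ k < G2 (x2 + t) \<and> r < G (x1 + t) (x2 + t)"
        by eventually_elim simp
      then have "\<forall>\<^sub>F t in at_left 0. \<theta> ^ k < G1 (x1 + t) \<and> \<theta> ^ k < G2 (x2 + t) \<and> r < G (x1 + t) (x2 + t)"
        by (simp add: eventually_at_split)
      moreover have "\<forall>\<^sub>F t in at_left 0. t < (0 :: real)" by (simp add: eventually_at_filter)
      ultimately have "\<forall>\<^sub>F t in at_left 0. \<theta> ^ k < G1 (x1 + t) \<and> \<theta> ^ k < G2 (x2 + t) \<and>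
          r < G (x1 + t) (x2 + t) \<and> t < 0"
        by eventually_elim simp
      then obtain t where t: "\<theta> ^ k < G1 (x1 + t)" "\<theta> ^ k < G2 (x2 + t)" "r < G (x1 + t) (x2 + t)" "t < 0"
        using eventually_happens'[OF trivial_limit_at_left_real] by blast
      have "\<forall>\<^sub>F n in sequentially. T n (y1 (x1 + t)) < x1" "\<forall>\<^sub>F n in sequentially. S n (y2 (x2 + t)) < x2"
        using order_tendstoD(2)[OF T[of "y1 (x1 + t)"], of x1] order_tendstoD(2)[OF S[of "y2 (x2 + t)"], of x2] t(4)
        by (simp_all add: y)
      moreover have "\<forall>\<^sub>F n in sequentially. r < N n (T n (y1 (x1 + t))) (S n (y2 (x2 + t)))"
        by (rule order_tendstoD(1)[OF along[OF t(1,2)] t(3)])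
      ultimately show "\<forall>\<^sub>F n in sequentially. r < N n x1 x2"
        by eventually_elim (meson N_mono less_imp_le less_le_trans)
    next
      fix r assume r: "G x1 x2 < r"
      have "\<forall>\<^sub>F t in at 0. G (x1 + t) (x2 + t) < r"
        by (rule order_tendstoD(2)[OF diagonal r])
      then have "\<forall>\<^sub>F t in at_right 0. G (x1 + t) (x2 + t) < r"
        by (simp add: eventually_at_split)
      moreover have "\<forall>\<^sub>F t in at_right 0. (0 :: real) < t" by (simp add: eventually_at_filter)
      ultimately have "\<forall>\<^sub>F t in at_right 0. G (x1 + t) (x2 + t) < r \<and> 0 < t"
        by eventually_elim simp
      then obtain t where t: "G (x1 + t) (x2 + t) < r" "0 < t"
        using eventually_happens'[OF trivial_limit_at_right_real] by blast
      have k': "\<theta> ^ k < G1 (x1 + t)" "\<theta> ^ k < G2 (x2 + t)"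
        using xk t(2) G1.g_mono[of x1 "x1 + t"] G2.g_mono[of x2 "x2 + t"] by auto
      have "\<forall>\<^sub>F n in sequentially. x1 < T n (y1 (x1 + t))" "\<forall>\<^sub>F n in sequentially. x2 < S n (y2 (x2 + t))"
        using order_tendstoD(1)[OF T[of "y1 (x1 + t)"], of x1] order_tendstoD(1)[OF S[of "y2 (x2 + t)"], of x2] t(2)
        by (simp_all add: y)
      moreover have "\<forall>\<^sub>F n in sequentially. N n (T n (y1 (x1 + t))) (S n (y2 (x2 + t))) < r"
        by (rule order_tendstoD(2)[OF along[OF k'] t(1)])
      ultimately show "\<forall>\<^sub>F n in sequentially. N n x1 x2 < r"
        by eventually_elim (meson N_mono less_imp_le le_less_trans)
    qed
  qed
  have zero: "(\<lambda>n. N n x1 x2) \<longlonglongrightarrow> 0"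
    if small: "\<And>r. 0 < r \<Longrightarrow> \<exists>z1 z2. x1 \<le> z1 \<and> x2 \<le> z2 \<and> 0 < G1 z1 \<and> 0 < G2 z2 \<and> G z1 z2 < r" for x1 x2
  proof (rule order_tendstoI)
    fix r :: real assume "r < 0"
    then show "\<forall>\<^sub>F n in sequentially. r < N n x1 x2"
      by (simp add: N_def less_trans[OF _ exp_gt_zero])
  next
    fix r :: real assume "0 < r"
    then obtain z1 z2 where z: "x1 \<le> z1" "x2 \<le> z2" "0 < G1 z1" "0 < G2 z2" "G z1 z2 < r"
      using small by blast
    show "\<forall>\<^sub>F n in sequentially. N n x1 x2 < r"
      using order_tendstoD(2)[OF pos[OF z(3,4)] z(5)]
      by eventually_elim (meson N_mono z(1,2) le_less_trans)
  qed
  have exists_above: "\<exists>z\<ge>x. 0 < g z" if "max_stable_df g" for g and x :: real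
  proof -
    interpret max_stable_df g by fact
    obtain z where "g z = 1 / 2" using g_surj[of "1 / 2"] by auto
    then have "0 < g (max x z)" using g_mono[of z "max x z"] by simp
    then show ?thesis by (metis max.cobounded1)
  qed
  have exists_small: "\<exists>z\<ge>x. 0 < g z \<and> g z < r" if "max_stable_df g" "g x = 0" "0 < r" for g and x r :: real
  proof -
    interpret max_stable_df g by fact
    have "0 < min (r / 2) (1 / 2)" "min (r / 2) (1 / 2) < 1" using that(3) by auto
    then obtain z where z: "g z = min (r / 2) (1 / 2)" using g_surj by blast
    then have "x < z" using g_less_imp[of x z] that(2,3) by auto
    then show ?thesis using z that(3) by (intro exI[of _ z]) auto
  qed
  have "(\<lambda>n. N n x1 x2) \<longlonglongrightarrow> G x1 x2"
  proof (cases "0 < G1 x1 \<and> 0 < G2 x2")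
    case False
    have "G x1 x2 = 0" using False by (auto simp: G_def bivariate_evd_eq)
    moreover have "(\<lambda>n. N n x1 x2) \<longlonglongrightarrow> 0"
    proof (rule zero)
      fix r :: real assume r: "0 < r"
      have "G1 x1 = 0 \<or> G2 x2 = 0"
        using False G1.g_nonneg[of x1] G2.g_nonneg[of x2] by linarith
      then show "\<exists>z1 z2. x1 \<le> z1 \<and> x2 \<le> z2 \<and> 0 < G1 z1 \<and> 0 < G2 z2 \<and> G z1 z2 < r"
        using exists_small[OF G1, of x1 r] exists_small[OF G2, of x2 r] exists_above[OF G1, of x1]
          exists_above[OF G2, of x2] r G_bounds by (meson le_less_trans)
    qed
    ultimately show ?thesis by simp
  qed (simp add: pos)
  then show ?thesis by (simp add: N_def G_def)
qed

section \<open>Classical and bi-free convergence\<close>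

text \<open>
Both sides are statements about the scaled tails \<open>n (1 - u)\<close>, \<open>n (1 - v)\<close> and \<open>n (1 - h)\<close>; positivity
of \<open>pos_one_plus_ln (G1 x)\<close> means \<open>G1 x > exp (- 1)\<close>, which is where the tail \<open>n (1 - u)\<close> has a limit
below \<open>1\<close>. Points at which one of the limits \<open>F1\<close>, \<open>F2\<close> vanishes are covered by the upper Frechet
bound in one direction and by \<open>bivariate_evd_domain_extends\<close> in the other.
\<close>

lemma classical_iff_bifree_tendsto:
  fixes H :: "real \<Rightarrow> real \<Rightarrow> real" and a b c d :: "nat \<Rightarrow> real"
  assumes A: "is_pickands A" and G1: "max_stable_df G1" and G2: "max_stable_df G2"
    and H: "is_bivariate_df H" and ac: "\<And>n. 0 < a n" "\<And>n. 0 < c n"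
  shows "(\<forall>x1 x2. (\<lambda>n. H (a n * x1 + b n) (c n * x2 + d n) ^ n) \<longlonglongrightarrow> bivariate_evd A G1 G2 x1 x2) \<longleftrightarrow>
    (\<forall>x1 x2. (\<lambda>n. bifree_maxpow H n (a n * x1 + b n) (c n * x2 + d n)) \<longlonglongrightarrow>
       bifree_copula A (pos_one_plus_ln (G1 x1)) (pos_one_plus_ln (G2 x2)))"
proof -
  interpret G1: max_stable_df G1 by fact
  interpret G2: max_stable_df G2 by fact
  note facts = bivariate_df_facts[OF H]
  define h where "h n x1 x2 = H (a n * x1 + b n) (c n * x2 + d n)" for n x1 x2
  define u where "u n x = marginal1 H (a n * x + b n)" for n x
  define v where "v n x = marginal2 H (c n * x + d n)" for n x
  define F1 where "F1 x = pos_one_plus_ln (G1 x)" for x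
  define F2 where "F2 x = pos_one_plus_ln (G2 x)" for x
  define G where "G = bivariate_evd A G1 G2"
  have frechet: "0 \<le> h n x1 x2" "h n x1 x2 \<le> u n x1" "h n x1 x2 \<le> v n x2"
    "u n x1 + v n x2 - 1 \<le> h n x1 x2" "u n x1 \<le> 1" "v n x2 \<le> 1" for n x1 x2
    unfolding h_def u_def v_def using facts(1-5) bivariate_df_frechet_lower[OF H] by auto
  have F: "0 \<le> F1 x" "F1 x \<le> 1" "0 \<le> F2 x" "F2 x \<le> 1" for x
    unfolding F1_def F2_def using pos_one_plus_ln_bounds G1.g_le_1 G2.g_le_1 by auto
  have F_top: "(F1 \<longlongrightarrow> 1) at_top" "(F2 \<longlongrightarrow> 1) at_top"
    using isCont_tendsto_compose[OF isCont_pos_one_plus_ln G1.g_at_top]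
      isCont_tendsto_compose[OF isCont_pos_one_plus_ln G2.g_at_top]
    by (auto simp: F1_def[abs_def] F2_def[abs_def] pos_one_plus_ln_def)
  have F_pos: "0 < F1 x \<longleftrightarrow> exp (- 1) < G1 x" "0 < F2 x \<longleftrightarrow> exp (- 1) < G2 x" for x
    by (simp_all add: F1_def F2_def pos_one_plus_ln_pos_iff)
  have G_pos: "0 < G1 x" "- ln (G1 x) = 1 - F1 x" if "0 < F1 x" for x
    using that by (auto simp: F1_def pos_one_plus_ln_def split: if_splits)
  have G_pos': "0 < G2 x" "- ln (G2 x) = 1 - F2 x" if "0 < F2 x" for x
    using that by (auto simp: F2_def pos_one_plus_ln_def split: if_splits)
  have classical: "(\<lambda>n. H (a n * x1 + b n) (c n * x2 + d n) ^ n) \<longlonglongrightarrow> bivariate_evd A G1 G2 x1 x2 \<longleftrightarrow>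
      (\<lambda>n. exp (- (n * (1 - h n x1 x2)))) \<longlonglongrightarrow> G x1 x2" for x1 x2
    unfolding G_def h_def
    by (rule tendsto_power_iff_tendsto_exp) (use facts(1) facts(2,4) order_trans in blast)+
  let ?val = "\<lambda>n x1 x2. maxpow_value n (u n x1) (v n x2) (h n x1 x2)"
  have bifree: "(\<lambda>n. bifree_maxpow H n (a n * x1 + b n) (c n * x2 + d n)) \<longlonglongrightarrow> r \<longleftrightarrow>
      (\<lambda>n. ?val n x1 x2) \<longlonglongrightarrow> r" for x1 x2 r
  proof (rule tendsto_cong)
    show "\<forall>\<^sub>F n in sequentially. bifree_maxpow H n (a n * x1 + b n) (c n * x2 + d n) = ?val n x1 x2"
      using eventually_ge_at_top[of 1]
      by eventually_elim (simp only: bifree_maxpow_eq_maxpow_value[OF H] u_def v_def h_def)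
  qed
  have denominator: "0 < 1 - (1 - F1 x1) - (1 - F2 x2) + tail_dependence A (1 - F1 x1) (1 - F2 x2)"
    if "0 < F1 x1" for x1 x2
    using bifree_copula_denominator(1)[OF A F(2)[of x1] F(4)[of x2]] that by linarith
  have copula_eq: "bifree_copula A (F1 x1) (F2 x2) = (1 - (1 - F1 x1)) * (1 - (1 - F2 x2)) /
      (1 - (1 - F1 x1) - (1 - F2 x2) + tail_dependence A (1 - F1 x1) (1 - F2 x2))"
    if "0 < F1 x1" "0 < F2 x2" for x1 x2
    using that by (simp add: bifree_copula_eq[OF A F] algebra_simps)
  have G_eq: "G x1 x2 = exp (- tail_dependence A (1 - F1 x1) (1 - F2 x2))" if "0 < F1 x1" "0 < F2 x2" for x1 x2
    using G_pos[OF that(1)] G_pos'[OF that(2)] by (simp add: G_def bivariate_evd_eq)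
  have "(\<forall>x1 x2. (\<lambda>n. exp (- (n * (1 - h n x1 x2)))) \<longlonglongrightarrow> G x1 x2) \<longleftrightarrow>
    (\<forall>x1 x2. (\<lambda>n. ?val n x1 x2) \<longlonglongrightarrow> bifree_copula A (F1 x1) (F2 x2))"
  proof (intro iffI allI)
    fix x1 x2
    assume "\<forall>x1 x2. (\<lambda>n. exp (- (n * (1 - h n x1 x2)))) \<longlonglongrightarrow> G x1 x2"
    then have lim: "(\<lambda>n. exp (- (n * (1 - h n x1 x2)))) \<longlonglongrightarrow> G x1 x2" for x1 x2 by blast
    have G_bounds: "G1 x1 * G2 x2 \<le> G x1 x2" "G x1 x2 \<le> G1 x1" "G x1 x2 \<le> G2 x2" for x1 x2
      using bivariate_evd_bounds[OF A, of G1 x1 G2 x2]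
      by (simp_all add: G_def G1.g_nonneg G1.g_le_1 G2.g_nonneg G2.g_le_1)
    have exp_frechet: "exp (- (n * (1 - h n x1 x2))) \<le> exp (- (n * (1 - u n x1)))"
      "exp (- (n * (1 - h n x1 x2))) \<le> exp (- (n * (1 - v n x2)))"
      "exp (- (n * (1 - u n x1))) + exp (- (n * (1 - v n x2))) - 1 \<le> exp (- (n * (1 - h n x1 x2)))"
      for n :: nat and x1 x2
    proof -
      let ?p = "exp (- (n * (1 - u n x1)))" and ?q = "exp (- (n * (1 - v n x2)))"
      show "exp (- (n * (1 - h n x1 x2))) \<le> ?p" "exp (- (n * (1 - h n x1 x2))) \<le> ?q"
        using frechet(2)[of n x1 x2] frechet(3)[of n x1 x2] by (simp_all add: mult_left_mono)
      \<comment> \<open>The Frechet bound for \<open>H\<close> makes the exponential dominate the product \<open>?p * ?q\<close>.\<close>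
      have "0 \<le> (1 - ?p) * (1 - ?q)"
        using frechet(5,6) by (intro mult_nonneg_nonneg) auto
      then have "?p + ?q - 1 \<le> ?p * ?q" by (simp add: algebra_simps)
      also have "\<dots> = exp (n * (u n x1 + v n x2 - 1) - n)"
        by (simp add: algebra_simps flip: exp_add)
      also have "\<dots> \<le> exp (n * h n x1 x2 - n)"
        using frechet(4)[of n x1 x2] by (simp add: mult_left_mono)
      finally show "?p + ?q - 1 \<le> exp (- (n * (1 - h n x1 x2)))" by (simp add: algebra_simps)
    qed
    have lim1: "(\<lambda>n. exp (- (n * (1 - u n x1)))) \<longlonglongrightarrow> G1 x1"
      using marginal_tendsto[where h = "\<lambda>n x1 x2. exp (- (real n * (1 - h n x1 x2)))"
          and u = "\<lambda>n x. exp (- (real n * (1 - u n x)))" and v = "\<lambda>n x. exp (- (real n * (1 - v n x)))",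
          OF exp_frechet lim G_bounds(1,2) G1.g_nonneg G1.g_le_1 G1.g_at_top G2.g_at_top] .
    have "(\<lambda>n. exp (- (real n * (1 - v n x2)))) \<longlonglongrightarrow> G2 x2"
      using marginal_tendsto[where h = "\<lambda>n x2 x1. exp (- (real n * (1 - h n x1 x2)))"
          and u = "\<lambda>n x. exp (- (real n * (1 - v n x)))" and v = "\<lambda>n x. exp (- (real n * (1 - u n x)))"
          and K = "\<lambda>x2 x1. G x1 x2" and ?k1.0 = G2 and ?k2.0 = G1, OF exp_frechet(2,1) _ lim _ G_bounds(3)
          G2.g_nonneg G2.g_le_1 G2.g_at_top G1.g_at_top]
        exp_frechet(3) G_bounds(1) by (simp add: mult.commute add.commute)
    note lim2 = this
    have "(\<lambda>n. pos_one_plus_ln (exp (- (n * (1 - u n x1))))) \<longlonglongrightarrow> F1 x1"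
      "(\<lambda>n. pos_one_plus_ln (exp (- (n * (1 - v n x2))))) \<longlonglongrightarrow> F2 x2"
      unfolding F1_def F2_def
      by (rule isCont_tendsto_compose[OF isCont_pos_one_plus_ln lim1]
          isCont_tendsto_compose[OF isCont_pos_one_plus_ln lim2])+
    then have upper: "(\<lambda>n. max 0 (1 - n * (1 - u n x1))) \<longlonglongrightarrow> F1 x1"
      "(\<lambda>n. max 0 (1 - n * (1 - v n x2))) \<longlonglongrightarrow> F2 x2"
      by (simp_all add: pos_one_plus_ln_exp)
    have val_bounds: "\<forall>\<^sub>F n in sequentially. 0 \<le> ?val n x1 x2"
      "\<forall>\<^sub>F n in sequentially. ?val n x1 x2 \<le> max 0 (1 - n * (1 - u n x1))"
      "\<forall>\<^sub>F n in sequentially. ?val n x1 x2 \<le> max 0 (1 - n * (1 - v n x2))"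
      using maxpow_value_bounds(1-3)[OF frechet]
      by (auto intro: eventually_mono[OF eventually_ge_at_top[of 1]])
    show "(\<lambda>n. ?val n x1 x2) \<longlonglongrightarrow> bifree_copula A (F1 x1) (F2 x2)"
    proof (cases "0 < F1 x1 \<and> 0 < F2 x2")
      case True
      then have pos: "0 < F1 x1" "0 < F2 x2" by auto
      have log: "(\<lambda>n. real n * w n) \<longlonglongrightarrow> - ln r" if "(\<lambda>n. exp (- (real n * w n))) \<longlonglongrightarrow> r" "0 < r" for w r
        using tendsto_minus[OF tendsto_ln[OF that(1)]] that(2) by simp
      have p: "(\<lambda>n. n * (1 - u n x1)) \<longlonglongrightarrow> 1 - F1 x1" and q: "(\<lambda>n. n * (1 - v n x2)) \<longlonglongrightarrow> 1 - F2 x2"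
        using log[OF lim1] log[OF lim2] G_pos[OF pos(1)] G_pos'[OF pos(2)] by simp_all
      have r: "(\<lambda>n. n * (1 - h n x1 x2)) \<longlonglongrightarrow> tail_dependence A (1 - F1 x1) (1 - F2 x2)"
        using log[OF lim[of x1 x2]] by (simp add: G_eq[OF pos])
      show ?thesis
        unfolding copula_eq[OF pos]
        by (rule maxpow_value_tendsto[OF p _ q _ r denominator[OF pos(1)]]) (use pos in auto)
    next
      case False
      then have "bifree_copula A (F1 x1) (F2 x2) = 0" by (auto simp: bifree_copula_eq[OF A F])
      moreover have "F1 x1 = 0 \<or> F2 x2 = 0" using False F(1)[of x1] F(3)[of x2] by linarith
      ultimately show ?thesis
        using tendsto_sandwich[OF val_bounds(1,2) tendsto_const]
          tendsto_sandwich[OF val_bounds(1,3) tendsto_const] upper by auto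
    qed
  next
    fix x1 x2
    assume "\<forall>x1 x2. (\<lambda>n. ?val n x1 x2) \<longlonglongrightarrow> bifree_copula A (F1 x1) (F2 x2)"
    then have lim: "(\<lambda>n. ?val n x1 x2) \<longlonglongrightarrow> bifree_copula A (F1 x1) (F2 x2)" for x1 x2 by blast
    note val_bounds = maxpow_value_bounds[OF frechet]
    note C_bounds = bifree_copula_bounds[OF A F]
    have upper1: "(\<lambda>n. max 0 (1 - n * (1 - u n x))) \<longlonglongrightarrow> F1 x" for x
      using marginal_tendsto[where h = ?val and u = "\<lambda>n x. max 0 (1 - real n * (1 - u n x))"
          and v = "\<lambda>n x. max 0 (1 - real n * (1 - v n x))",
          OF val_bounds(2-4) lim C_bounds(1,2) F(1,2) F_top] .
    have upper2: "(\<lambda>n. max 0 (1 - n * (1 - v n x))) \<longlonglongrightarrow> F2 x" for x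
      using marginal_tendsto[where h = "\<lambda>n x2 x1. ?val n x1 x2" and u = "\<lambda>n x. max 0 (1 - real n * (1 - v n x))"
          and v = "\<lambda>n x. max 0 (1 - real n * (1 - u n x))"
          and K = "\<lambda>x2 x1. bifree_copula A (F1 x1) (F2 x2)" and ?k1.0 = F2 and ?k2.0 = F1,
          OF val_bounds(3,2) _ lim _ C_bounds(3) F(3,4) F_top(2,1)]
        val_bounds(4) C_bounds(1) by (simp add: mult.commute add.commute)
    have unmax: "w \<longlonglongrightarrow> 1 - r" if w: "(\<lambda>n. max 0 (1 - w n)) \<longlonglongrightarrow> r" and r: "0 < r" for w :: "nat \<Rightarrow> real" and r
    proof -
      have "(\<lambda>n. 1 - max 0 (1 - w n)) \<longlonglongrightarrow> 1 - r" by (intro tendsto_intros w)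
      moreover have "\<forall>\<^sub>F n in sequentially. 1 - max 0 (1 - w n) = w n"
        using order_tendstoD(1)[OF w r] by eventually_elim (auto simp: max_def split: if_splits)
      ultimately show ?thesis by (rule Lim_transform_eventually)
    qed
    have p: "(\<lambda>n. n * (1 - u n x)) \<longlonglongrightarrow> 1 - F1 x" if "0 < F1 x" for x
      by (rule unmax[OF upper1 that])
    have q: "(\<lambda>n. n * (1 - v n x)) \<longlonglongrightarrow> 1 - F2 x" if "0 < F2 x" for x
      by (rule unmax[OF upper2 that])
    have r: "(\<lambda>n. n * (1 - h n x1 x2)) \<longlonglongrightarrow> tail_dependence A (1 - F1 x1) (1 - F2 x2)"
      if pos: "0 < F1 x1" "0 < F2 x2" for x1 x2
      by (rule scaled_tendsto_if_maxpow_value_tendsto[OF p[OF pos(1)] _ q[OF pos(2)] _ denominator[OF pos(1)]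
            lim[of x1 x2, unfolded copula_eq[OF pos]]]) (use pos in auto)
    have expG1: "exp (- (1 - F1 x)) = G1 x" if "0 < F1 x" for x
      using G_pos[OF that] by (metis add.inverse_inverse exp_ln)
    have expG2: "exp (- (1 - F2 x)) = G2 x" if "0 < F2 x" for x
      using G_pos'[OF that] by (metis add.inverse_inverse exp_ln)
    show "(\<lambda>n. exp (- (n * (1 - h n x1 x2)))) \<longlonglongrightarrow> G x1 x2"
      unfolding h_def G_def
    proof (rule bivariate_evd_domain_extends[OF A G1 G2 H ac, where \<theta> = "exp (- 1)"])
      fix x assume x: "exp (- 1) < G1 x"
      show "(\<lambda>n. exp (- (n * (1 - marginal1 H (a n * x + b n))))) \<longlonglongrightarrow> G1 x"
        using tendsto_exp[OF tendsto_minus[OF p[of x]]] x F_pos expG1 by (simp add: u_def)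
    next
      fix x assume x: "exp (- 1) < G2 x"
      show "(\<lambda>n. exp (- (n * (1 - marginal2 H (c n * x + d n))))) \<longlonglongrightarrow> G2 x"
        using tendsto_exp[OF tendsto_minus[OF q[of x]]] x F_pos expG2 by (simp add: v_def)
    next
      fix x1 x2 assume x: "exp (- 1) < G1 x1" "exp (- 1) < G2 x2"
      then show "(\<lambda>n. exp (- (n * (1 - H (a n * x1 + b n) (c n * x2 + d n))))) \<longlonglongrightarrow> bivariate_evd A G1 G2 x1 x2"
        using tendsto_exp[OF tendsto_minus[OF r[of x1 x2]]] F_pos G_eq[of x1 x2] by (simp add: h_def G_def)
    qed auto
  qed
  then show ?thesis
    unfolding classical bifree F1_def F2_def .
qed

lemma weak_conv2_iff_pointwise:
  assumes "\<And>x1 x2. isCont (\<lambda>(y1, y2). F y1 y2) (x1, x2)"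
  shows "weak_conv2 Fs F \<longleftrightarrow> (\<forall>x1 x2. (\<lambda>n. Fs n x1 x2) \<longlonglongrightarrow> F x1 x2)"
  using assms by (simp add: weak_conv2_def)

theorem theorem8p3:
  fixes A G1 G2 F1 F2 :: "real \<Rightarrow> real"
    and F G :: "real \<Rightarrow> real \<Rightarrow> real"
  assumes "is_extreme_value_df G1" and "is_extreme_value_df G2"
    and "is_pickands A"
    and "F1 = (\<lambda>x. pos_one_plus_ln (G1 x))" and "F2 = (\<lambda>x. pos_one_plus_ln (G2 x))"
    and "G = bivariate_evd A G1 G2"
    and "F = (\<lambda>x1 x2. bifree_copula A (F1 x1) (F2 x2))"
  shows "classical_max_domain G = bifree_max_domain F \<and>
    (\<forall>(H :: real \<Rightarrow> real \<Rightarrow> real) (a :: nat \<Rightarrow> real) (b :: nat \<Rightarrow> real)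
        (c :: nat \<Rightarrow> real) (d :: nat \<Rightarrow> real).
       is_bivariate_df H \<longrightarrow> (\<forall>n. a n > 0 \<and> c n > 0) \<longrightarrow>
       (weak_conv2 (\<lambda>n x1 x2. H (a n * x1 + b n) (c n * x2 + d n) ^ n) G \<longleftrightarrow>
        weak_conv2 (\<lambda>n x1 x2. bifree_maxpow H n (a n * x1 + b n) (c n * x2 + d n)) F))"
proof -
  have ms: "max_stable_df G1" "max_stable_df G2"
    using assms(1,2) max_stable_gev_df by (auto simp: is_extreme_value_df_def)
  interpret G1: max_stable_df G1 by (rule ms)
  interpret G2: max_stable_df G2 by (rule ms)
  have cont_G: "isCont (\<lambda>(y1, y2). G y1 y2) (x1, x2)" for x1 x2
    unfolding assms(6)
    by (intro isCont_bivariate_evd[OF assms(3)] G1.isCont_g G2.isCont_g)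
       (simp_all add: G1.g_nonneg G1.g_le_1 G2.g_nonneg G2.g_le_1)
  have cont_F: "isCont (\<lambda>(y1, y2). F y1 y2) (x1, x2)" for x1 x2
    unfolding assms(7)
  proof (rule isCont_bifree_copula[OF assms(3)])
    show "isCont F1 x1" "isCont F2 x2"
      unfolding assms(4,5)
      by (rule isCont_o2[OF G1.isCont_g isCont_pos_one_plus_ln]
          isCont_o2[OF G2.isCont_g isCont_pos_one_plus_ln])+
  qed (simp_all add: assms(4,5) pos_one_plus_ln_bounds G1.g_le_1 G2.g_le_1)
  have iff: "weak_conv2 (\<lambda>n x1 x2. H (a n * x1 + b n) (c n * x2 + d n) ^ n) G \<longleftrightarrow>
      weak_conv2 (\<lambda>n x1 x2. bifree_maxpow H n (a n * x1 + b n) (c n * x2 + d n)) F"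
    if "is_bivariate_df H" "\<forall>n. a n > 0 \<and> c n > 0" for H and a b c d :: "nat \<Rightarrow> real"
    using classical_iff_bifree_tendsto[OF assms(3) ms that(1), of a c b d] that(2)
    unfolding weak_conv2_iff_pointwise[OF cont_G] weak_conv2_iff_pointwise[OF cont_F]
    by (simp add: assms(4-7))
  have "classical_max_domain G = bifree_max_domain F"
    unfolding classical_max_domain_def bifree_max_domain_def
    by (intro Collect_cong conj_cong refl ex_cong1) (rule iff)
  with iff show ?thesis by blast
qed

end
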